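(* Let $\mathbf{A}$ be an $n\times n$ Hermitian matrix and $\mathbf{b}\in\mathbb{C}^n$ a nonzero vector, and let $\mathbf{Q}_k,\mathbf{T}_k$ be the output of the Lanczos algorithm run on $(\mathbf{A},\mathbf{b})$ for $k$ steps. Suppose that for some real $w<\lambda_{\min}(\mathbf{A})$, $f$ is analytic in a neighborhood of the disk $\mathcal{D}(\lambda_{\max}(\mathbf{A}),\lambda_{\max}(\mathbf{A})-w)$. Then, taking $\Gamma$ to be the boundary of this disk, $$\|f(\mathbf{A})\mathbf{b}-\mathsf{lan}_k(f)\|\le\left(\frac{1}{2\pi}\oint_\Gamma|f(z)|\,|\mathrm{d}z|\right)\|\mathsf{err}_k(w)\|\le\left((\lambda_{\max}(\mathbf{A})-w)\max_{z\in\Gamma}|f(z)|\right)\|\mathsf{err}_k(w)\|.$$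
   Context: Lanczos algorithm (exact arithmetic): given Hermitian $\mathbf{A}$ and $\mathbf{b}\neq 0$, set $\mathbf{q}_0=0$, $\beta_0=0$, $\mathbf{q}_1=\mathbf{b}/\|\mathbf{b}\|_2$, and for $j=1,\dots,k$: $\tilde{\mathbf{q}}=\mathbf{A}\mathbf{q}_j-\beta_{j-1}\mathbf{q}_{j-1}$, $\alpha_j=\langle\tilde{\mathbf{q}},\mathbf{q}_j\rangle$, $\tilde{\mathbf{q}}_{j+1}=\tilde{\mathbf{q}}-\alpha_j\mathbf{q}_j$, $\beta_j=\|\tilde{\mathbf{q}}_{j+1}\|_2$, $\mathbf{q}_{j+1}=\tilde{\mathbf{q}}_{j+1}/\beta_j$ (it is assumed that the algorithm does not break down, i.e. the divisions needed to produce $\mathbf{q}_1,\dots,\mathbf{q}_k$ are by nonzero numbers). The output is $\mathbf{Q}_k=[\mathbf{q}_1,\dots,\mathbf{q}_k]$, which has orthonormal columns, and the real symmetric tridiagonal $k\times k$ matrix $\mathbf{T}_k$ with diagonal $\alpha_1,\dots,\alpha_k$ and off-diagonal $\beta_1,\dots,\beta_{k-1}$; they satisfy $\mathbf{A}\mathbf{Q}_k=\mathbf{Q}_k\mathbf{T}_k+\beta_k\mathbf{q}_{k+1}\mathbf{e}_k^{\mathsf T}$. $\mathsf{lan}_k(f):=\mathbf{Q}_k f(\mathbf{T}_k)\mathbf{Q}_k^{\mathsf H}\mathbf{b}$, and $\mathsf{err}_k(w):=(\mathbf{A}-w\mathbf{I})^{-1}\mathbf{b}-\mathbf{Q}_k(\mathbf{T}_k-w\mathbf{I})^{-1}\mathbf{Q}_k^{\mathsf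 H}\mathbf{b}$. $\lambda_{\min}(\mathbf{A})$ and $\lambda_{\max}(\mathbf{A})$ are the smallest and largest eigenvalues of $\mathbf{A}$; $\mathcal{D}(c,t)$ is the closed disc in the complex plane with center $c$ and radius $t$. Matrix functions of Hermitian matrices are defined through the eigendecomposition. $\|\cdot\|$ is any norm $\|\mathbf{v}\|=\sqrt{\mathbf{v}^{\mathsf H}\mathbf{M}\mathbf{v}}$ induced by a positive definite matrix $\mathbf{M}$ that commutes with $\mathbf{A}$ (has the same eigenvectors as $\mathbf{A}$). *)

theory Defs
  imports
    "HOL-Complex_Analysis.Complex_Analysis"
    "Jordan_Normal_Form.Spectral_Radius"
    "Jordan_Normal_Form.Schur_Decomposition"
    "Jordan_Normal_Form.Gauss_Jordan_Elimination"
begin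

no_notation Finite_Cartesian_Product.vec_nth (infixl "$" 90)
no_notation Inner_Product.real_inner_class.inner (infix "\<bullet>" 70)
hide_const (open) Finite_Cartesian_Product.mat Finite_Cartesian_Product.vec
hide_type (open) Finite_Cartesian_Product.vec

definition hermitian_mat :: "complex mat \<Rightarrow> bool" where
  "hermitian_mat A \<longleftrightarrow> mat_adjoint A = A"

definition unitary_mat :: "nat \<Rightarrow> complex mat \<Rightarrow> bool" where
  "unitary_mat n U \<longleftrightarrow> U \<in> carrier_mat n n \<and>
     mat_adjoint U * U = 1\<^sub>m n \<and> U * mat_adjoint U = 1\<^sub>m n"

definition norm2_vec :: "complex vec \<Rightarrow> real" where
  "norm2_vec v = sqrt (Re (v \<bullet>c v))"

definition pos_def_mat :: "nat \<Rightarrow> complex mat \<Rightarrow> bool" where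
  "pos_def_mat n M \<longleftrightarrow> M \<in> carrier_mat n n \<and> hermitian_mat M \<and>
     (\<forall>v \<in> carrier_vec n. v \<noteq> 0\<^sub>v n \<longrightarrow> 0 < Re ((M *\<^sub>v v) \<bullet>c v))"

text \<open>Since \<open>u \<bullet>c v\<close> conjugates its second argument, \<open>(M *\<^sub>v v) \<bullet>c v\<close> is
  $v^{\mathsf H} M v$.\<close>

definition norm_induced :: "complex mat \<Rightarrow> complex vec \<Rightarrow> real" where
  "norm_induced M v = sqrt (Re ((M *\<^sub>v v) \<bullet>c v))"

text \<open>Extreme eigenvalues of a Hermitian matrix, all of whose eigenvalues are real.\<close>

definition lambda_min :: "complex mat \<Rightarrow> real" where
  "lambda_min A = Min (Re ` spectrum A)"

definition lambda_max :: "complex mat \<Rightarrow> real" where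
  "lambda_max A = Max (Re ` spectrum A)"

definition eigendecomposition :: "complex mat \<Rightarrow> complex mat \<Rightarrow> (nat \<Rightarrow> complex) \<Rightarrow> bool" where
  "eigendecomposition A U d \<longleftrightarrow> unitary_mat (dim_row A) U \<and>
     A = U * mat_diag (dim_row A) d * mat_adjoint U"

text \<open>The value does not depend on the chosen eigendecomposition; see \<open>mat_fun_eq\<close> below.\<close>

definition mat_fun :: "(complex \<Rightarrow> complex) \<Rightarrow> complex mat \<Rightarrow> complex mat" where
  "mat_fun f A = (SOME B. \<exists>U d. eigendecomposition A U d \<and>
     B = U * mat_diag (dim_row A) (\<lambda>i. f (d i)) * mat_adjoint U)"

lemma mat_adjoint_carrier: "U \<in> carrier_mat n m \<Longrightarrow> mat_adjoint U \<in> carrier_mat m n"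
  using mat_of_rows_carrier(1)[of "dim_row U" "map conjugate (cols U)"]
  by (simp add: mat_adjoint_def)

lemma eigendecomposition_fun_unique:
  assumes U: "eigendecomposition A U d" and V: "eigendecomposition A V e"
  shows "U * mat_diag (dim_row A) (\<lambda>i. f (d i)) * mat_adjoint U =
         V * mat_diag (dim_row A) (\<lambda>i. f (e i)) * mat_adjoint V"
proof -
  define n where "n = dim_row A"
  define U' where "U' = mat_adjoint U"
  define V' where "V' = mat_adjoint V"
  define D where "D g = mat_diag n (\<lambda>i. g (d i))" for g :: "complex \<Rightarrow> complex"
  define E where "E g = mat_diag n (\<lambda>i. g (e i))" for g :: "complex \<Rightarrow> complex"
  have un: "unitary_mat n U" "unitary_mat n V"
    unfolding n_def
    by (rule conjunct1[OF U[unfolded eigendecomposition_def]]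
          conjunct1[OF V[unfolded eigendecomposition_def]])+
  have dec: "A = U * D (\<lambda>x. x) * U'" "A = V * E (\<lambda>x. x) * V'"
    unfolding n_def U'_def V'_def D_def E_def
    by (rule conjunct2[OF U[unfolded eigendecomposition_def]]
          conjunct2[OF V[unfolded eigendecomposition_def]])+
  have c: "U \<in> carrier_mat n n" "V \<in> carrier_mat n n"
    using un by (auto simp: unitary_mat_def)
  have c': "U' \<in> carrier_mat n n" "V' \<in> carrier_mat n n"
    using c by (auto simp: U'_def V'_def mat_adjoint_carrier)
  have cD: "D g \<in> carrier_mat n n" "E g \<in> carrier_mat n n" for g
    by (auto simp: D_def E_def)
  have id: "U' * U = 1\<^sub>m n" "U * U' = 1\<^sub>m n" "V' * V = 1\<^sub>m n" "V * V' = 1\<^sub>m n"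
    using un by (auto simp: unitary_mat_def U'_def V'_def)
  have eq: "U * D (\<lambda>x. x) * U' = V * E (\<lambda>x. x) * V'"
    by (rule trans[OF dec(1)[symmetric] dec(2)])
  have mc: "X * Y \<in> carrier_mat n n" if "X \<in> carrier_mat n n" "Y \<in> carrier_mat n n"
    for X Y :: "complex mat"
    using that by (rule mult_carrier_mat)
  have asc: "(X * Y) * Z = X * (Y * Z)"
    if "X \<in> carrier_mat n n" "Y \<in> carrier_mat n n" "Z \<in> carrier_mat n n"
    for X Y Z :: "complex mat"
    using that by (rule assoc_mult_mat)
  define W where "W = U' * V"
  have cW: "W \<in> carrier_mat n n" using c c' by (auto simp: W_def)
  have "D (\<lambda>x. x) * W = U' * (U * D (\<lambda>x. x) * U') * V"
  proof -
    have "U' * (U * D (\<lambda>x. x) * U') * V = (U' * U) * D (\<lambda>x. x) * (U' * V)"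
      using c c' cD by (simp add: asc mc)
    thus ?thesis using cD[of "\<lambda>x. x"] by (simp add: id W_def)
  qed
  also have "\<dots> = U' * (V * E (\<lambda>x. x) * V') * V" by (simp add: eq)
  also have "\<dots> = (U' * V) * E (\<lambda>x. x) * (V' * V)"
    using c c' cD by (simp add: asc mc)
  also have "\<dots> = W * E (\<lambda>x. x)"
    using cW cD[of "\<lambda>x. x"] by (simp add: id W_def[symmetric])
  finally have comm: "D (\<lambda>x. x) * W = W * E (\<lambda>x. x)" .
  have entry: "d i * W $$ (i,j) = W $$ (i,j) * e j" if "i < n" "j < n" for i j
    using arg_cong[OF comm, of "\<lambda>X. X $$ (i,j)"] that
    by (simp add: D_def E_def mat_diag_mult_left[OF cW] mat_diag_mult_right[OF cW])
  have commf: "D f * W = W * E f"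
  proof (rule eq_matI)
    fix i j assume "i < dim_row (W * E f)" "j < dim_col (W * E f)"
    hence ij: "i < n" "j < n" using cW cD[of f] by auto
    have "W $$ (i,j) = 0 \<or> d i = e j" 
      using entry[OF ij] mult_cancel_left[of "W $$ (i,j)" "d i" "e j"]
      by (simp only: mult.commute[of "d i" "W $$ (i,j)"])
    thus "(D f * W) $$ (i,j) = (W * E f) $$ (i,j)"
      using ij by (auto simp: D_def E_def mat_diag_mult_left[OF cW] mat_diag_mult_right[OF cW])
  qed (use cW cD[of f] in auto)
  have "U * D f * U' = U * D f * U' * (V * V')"
    using right_mult_one_mat[OF mc[OF mc[OF c(1) cD(1)] c'(1)]] by (simp add: id)
  also have "\<dots> = U * (D f * W) * V'"
    using c c' cD[of f] by (simp add: W_def asc mc)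
  also have "\<dots> = U * (W * E f) * V'" by (simp add: commf)
  also have "\<dots> = (U * U') * V * E f * V'"
    using c c' cD[of f] by (simp add: W_def asc mc)
  also have "\<dots> = V * E f * V'" using c by (simp add: id)
  finally show ?thesis by (simp add: D_def E_def U'_def V'_def n_def)
qed

lemma mat_fun_eq:
  assumes "eigendecomposition A U d"
  shows "mat_fun f A = U * mat_diag (dim_row A) (\<lambda>i. f (d i)) * mat_adjoint U"
  unfolding mat_fun_def
proof (rule some_equality)
  fix B assume "\<exists>V e. eigendecomposition A V e \<and>
    B = V * mat_diag (dim_row A) (\<lambda>i. f (e i)) * mat_adjoint V"
  then obtain V e where V: "eigendecomposition A V e"
    and B: "B = V * mat_diag (dim_row A) (\<lambda>i. f (e i)) * mat_adjoint V" by blast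
  show "B = U * mat_diag (dim_row A) (\<lambda>i. f (d i)) * mat_adjoint U"
    unfolding B by (rule eigendecomposition_fun_unique[OF V assms])
qed (intro exI conjI, rule assms, rule refl)

text \<open>In the algorithm's notation, \<open>lanczos_qt A b j\<close> is the vector $\tilde q$ of step $j$
  and \<open>lanczos_r A b j\<close> is $\tilde q_{j+1}$. The values of \<open>lanczos_qt\<close>, \<open>lanczos_alpha\<close> and
  \<open>lanczos_r\<close> at index 0 are dummies, as the steps start at 1. For Hermitian \<open>A\<close> the
  coefficients $\alpha_j$ are real numbers.\<close>

fun lanczos_q :: "complex mat \<Rightarrow> complex vec \<Rightarrow> nat \<Rightarrow> complex vec"
  and lanczos_qt :: "complex mat \<Rightarrow> complex vec \<Rightarrow> nat \<Rightarrow> complex vec"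
  and lanczos_alpha :: "complex mat \<Rightarrow> complex vec \<Rightarrow> nat \<Rightarrow> complex"
  and lanczos_r :: "complex mat \<Rightarrow> complex vec \<Rightarrow> nat \<Rightarrow> complex vec"
  and lanczos_beta :: "complex mat \<Rightarrow> complex vec \<Rightarrow> nat \<Rightarrow> real"
where
  "lanczos_q A b 0 = 0\<^sub>v (dim_vec b)"
| "lanczos_q A b (Suc 0) = complex_of_real (1 / norm2_vec b) \<cdot>\<^sub>v b"
| "lanczos_q A b (Suc (Suc j)) =
     complex_of_real (1 / lanczos_beta A b (Suc j)) \<cdot>\<^sub>v lanczos_r A b (Suc j)"
| "lanczos_qt A b 0 = 0\<^sub>v (dim_vec b)"
| "lanczos_qt A b (Suc j) =
     A *\<^sub>v lanczos_q A b (Suc j) - complex_of_real (lanczos_beta A b j) \<cdot>\<^sub>v lanczos_q A b j"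
| "lanczos_alpha A b 0 = 0"
| "lanczos_alpha A b (Suc j) = lanczos_qt A b (Suc j) \<bullet>c lanczos_q A b (Suc j)"
| "lanczos_r A b 0 = 0\<^sub>v (dim_vec b)"
| "lanczos_r A b (Suc j) =
     lanczos_qt A b (Suc j) - lanczos_alpha A b (Suc j) \<cdot>\<^sub>v lanczos_q A b (Suc j)"
| "lanczos_beta A b 0 = 0"
| "lanczos_beta A b (Suc j) = norm2_vec (lanczos_r A b (Suc j))"

definition lanczos_Q :: "complex mat \<Rightarrow> complex vec \<Rightarrow> nat \<Rightarrow> complex mat" where
  "lanczos_Q A b k = mat_of_cols (dim_vec b) (map (lanczos_q A b) [1..<Suc k])"

text \<open>Matrix indices start at 0, so entry \<open>(i, i)\<close> is $\alpha_{i+1}$.\<close>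

definition lanczos_T :: "complex mat \<Rightarrow> complex vec \<Rightarrow> nat \<Rightarrow> complex mat" where
  "lanczos_T A b k = Matrix.mat k k (\<lambda>(i, j).
     if i = j then lanczos_alpha A b (Suc i)
     else if j = Suc i then complex_of_real (lanczos_beta A b (Suc i))
     else if i = Suc j then complex_of_real (lanczos_beta A b (Suc j))
     else 0)"

definition lanczos_no_breakdown :: "complex mat \<Rightarrow> complex vec \<Rightarrow> nat \<Rightarrow> bool" where
  "lanczos_no_breakdown A b k \<longleftrightarrow>
     norm2_vec b \<noteq> 0 \<and> (\<forall>j. 1 \<le> j \<and> j < k \<longrightarrow> lanczos_beta A b j \<noteq> 0)"

definition lan :: "complex mat \<Rightarrow> complex vec \<Rightarrow> nat \<Rightarrow> (complex \<Rightarrow> complex) \<Rightarrow> complex vec" where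
  "lan A b k f =
     lanczos_Q A b k *\<^sub>v (mat_fun f (lanczos_T A b k) *\<^sub>v (mat_adjoint (lanczos_Q A b k) *\<^sub>v b))"

text \<open>The resolvent $(A - wI)^{-1}$; \<open>mat_inverse\<close> yields \<open>None\<close> only for singular matrices.\<close>

definition resolvent :: "complex mat \<Rightarrow> complex \<Rightarrow> complex mat" where
  "resolvent A w = the (mat_inverse (A - w \<cdot>\<^sub>m 1\<^sub>m (dim_row A)))"

definition lan_err :: "complex mat \<Rightarrow> complex vec \<Rightarrow> nat \<Rightarrow> complex \<Rightarrow> complex vec" where
  "lan_err A b k w = resolvent A w *\<^sub>v b -
     lanczos_Q A b k *\<^sub>v (resolvent (lanczos_T A b k) w *\<^sub>v (mat_adjoint (lanczos_Q A b k) *\<^sub>v b))"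

text \<open>The integral $\oint_\gamma g(z)\,|\mathrm{d}z|$ with respect to arc length, in the
  style of \<open>contour_integral\<close>.\<close>

definition arclength_integral :: "(real \<Rightarrow> complex) \<Rightarrow> (complex \<Rightarrow> real) \<Rightarrow> real" where
  "arclength_integral \<gamma> g =
     integral {0..1} (\<lambda>t. g (\<gamma> t) * norm (vector_derivative \<gamma> (at t within {0..1})))"

end

theory Submission
  imports Defs
begin

text \<open>
  Let $A = U \,\mathrm{diag}(d)\, U^{\mathsf H}$ and $T_k = V \,\mathrm{diag}(\theta)\, V^{\mathsf H}$.
  The $i$-th coordinate of $f(A)b - \mathsf{lan}_k(f)$ in the eigenbasis of $A$ is a functional
  $L_i(f) = y_i f(d_i) - \sum_j a_{ij} f(\theta_j)$, which vanishes on polynomials of degree less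
  than $k$ by the Krylov structure. With $\chi(x) = \prod_j (x - \theta_j)$, the quotient
  $(\chi(x) - \chi(z)) / (x - z)$ is such a polynomial in $x$, so
  $L_i(1/(x-z)) = y_i \chi(d_i) / (\chi(z) (d_i - z))$. Hence the errors at $z$ and at $w$ differ by
  the factor $\frac{\chi(w)}{\chi(z)} \cdot \frac{d_i - w}{d_i - z}$, whose modulus is at most 1 on
  the circle, because all $d_i$ and $\theta_j$ lie in $[\lambda_{\min}, \lambda_{\max}]$. By Cauchy's
  formula, $L_i(f) = G(d_i) L_i(1/(x-w))$ with a scalar contour integral $G$ bounded by
  $\frac{1}{2\pi}\oint|f|\,|\mathrm{d}z|$. Finally, as $M$ commutes with $A$, its quadratic form
  splits over the eigenspaces of $A$, on each of which $G(A)$ acts as a scalar.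
\<close>

subsection \<open>Adjoints and the spectral theorem\<close>

lemma mat_adjoint_dim [simp]:
  "dim_row (mat_adjoint A) = dim_col A" "dim_col (mat_adjoint A) = dim_row A"
  by (simp_all add: mat_adjoint_def)

lemma mat_adjoint_index:
  "i < dim_col A \<Longrightarrow> j < dim_row A \<Longrightarrow> mat_adjoint A $$ (i, j) = cnj (A $$ (j, i))"
  by (simp add: mat_adjoint_def mat_of_rows_index)

lemma cscalar_prod_sum: "y \<in> carrier_vec n \<Longrightarrow> x \<bullet>c y = (\<Sum>i<n. x $ i * cnj (y $ i))"
  by (auto simp: scalar_prod_def lessThan_atLeast0 intro!: sum.cong)

lemma mult_mat_vec_sum:
  "A \<in> carrier_mat m n \<Longrightarrow> x \<in> carrier_vec n \<Longrightarrow> i < m \<Longrightarrow> (A *\<^sub>v x) $ i = (\<Sum>j<n. A $$ (i, j) * x $ j)"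
  by (auto simp: scalar_prod_def lessThan_atLeast0 intro!: sum.cong)

lemma mat_adjoint_adjoint [simp]: "mat_adjoint (mat_adjoint A) = (A :: complex mat)"
  by (rule eq_matI) (auto simp: mat_adjoint_index)

lemma mat_adjoint_mult:
  fixes A B :: "complex mat"
  assumes "A \<in> carrier_mat m n" "B \<in> carrier_mat n l"
  shows "mat_adjoint (A * B) = mat_adjoint B * mat_adjoint A"
  using assms
  by (intro eq_matI)
     (auto simp: mat_adjoint_index scalar_prod_def mult.commute intro!: sum.cong)

lemma cscalar_prod_swap:
  fixes x y :: "complex vec"
  assumes "x \<in> carrier_vec n" "y \<in> carrier_vec n"
  shows "cnj (x \<bullet>c y) = y \<bullet>c x"
  using assms by (simp add: cscalar_prod_sum mult.commute)

lemma cscalar_prod_adjoint: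
  fixes A :: "complex mat"
  assumes A: "A \<in> carrier_mat m n" and x: "x \<in> carrier_vec n" and y: "y \<in> carrier_vec m"
  shows "(A *\<^sub>v x) \<bullet>c y = x \<bullet>c (mat_adjoint A *\<^sub>v y)"
proof -
  have "(A *\<^sub>v x) \<bullet>c y = (\<Sum>i<m. \<Sum>j<n. A $$ (i, j) * x $ j * cnj (y $ i))"
    using y by (simp add: cscalar_prod_sum mult_mat_vec_sum[OF A x] sum_distrib_right del: index_mult_mat_vec)
  also have "\<dots> = (\<Sum>j<n. \<Sum>i<m. A $$ (i, j) * x $ j * cnj (y $ i))"
    by (rule sum.swap)
  also have "\<dots> = (\<Sum>j<n. x $ j * cnj ((mat_adjoint A *\<^sub>v y) $ j))"
  proof (rule sum.cong[OF refl])
    fix j assume "j \<in> {..<n}"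
    thus "(\<Sum>i<m. A $$ (i, j) * x $ j * cnj (y $ i)) = x $ j * cnj ((mat_adjoint A *\<^sub>v y) $ j)"
      using A by (subst mult_mat_vec_sum[OF mat_adjoint_carrier[OF A] y])
         (auto simp: mat_adjoint_index sum_distrib_left mult_ac intro!: sum.cong)
  qed
  also have "\<dots> = x \<bullet>c (mat_adjoint A *\<^sub>v y)"
    by (subst cscalar_prod_sum[of _ n]) (use A y mat_adjoint_carrier[OF A] in auto)
  finally show ?thesis .
qed

lemma hermitian_cscalar_prod:
  assumes "A \<in> carrier_mat n n" "hermitian_mat A" "x \<in> carrier_vec n" "y \<in> carrier_vec n"
  shows "(A *\<^sub>v x) \<bullet>c y = x \<bullet>c (A *\<^sub>v y)"
  using cscalar_prod_adjoint[OF assms(1,3,4)] assms(2) by (simp add: hermitian_mat_def)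

text \<open>Nonnegativity in the order on the complex numbers includes a vanishing imaginary part,
  so the \<open>Re\<close> in \<open>norm2_vec\<close> discards nothing.\<close>

lemma cscalar_prod_self: "x \<bullet>c x = complex_of_real (norm2_vec x ^ 2)"
proof -
  have "x \<bullet>c x \<ge> 0" by (rule conjugate_square_ge_0_vec)
  thus ?thesis by (simp add: norm2_vec_def less_eq_complex_def complex_eq_iff)
qed

lemma norm2_vec_eq_0_iff: "x \<in> carrier_vec n \<Longrightarrow> norm2_vec x = 0 \<longleftrightarrow> x = 0\<^sub>v n"
  using conjugate_square_eq_0_vec[of x n] unfolding cscalar_prod_self by simp

lemma cscalar_prod_smult_left:
  "dim_vec x = dim_vec y \<Longrightarrow> (c \<cdot>\<^sub>v x) \<bullet>c y = c * (x \<bullet>c (y :: complex vec))"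
  by simp

lemma cscalar_prod_smult_right:
  "dim_vec x = dim_vec y \<Longrightarrow> x \<bullet>c (c \<cdot>\<^sub>v y) = cnj c * (x \<bullet>c (y :: complex vec))"
  by (simp add: conjugate_smult_vec)

text \<open>For square matrices a left inverse is also a right inverse.\<close>

lemma unitary_matI:
  assumes "W \<in> carrier_mat n n" "mat_adjoint W * W = 1\<^sub>m n"
  shows "unitary_mat n W"
  using assms mat_mult_left_right_inverse[OF mat_adjoint_carrier[OF assms(1)] assms(1)]
  by (simp add: unitary_mat_def)

lemma adjoint_mult_index:
  fixes P Q :: "complex mat"
  assumes "P \<in> carrier_mat n m" "Q \<in> carrier_mat n l" "i < m" "j < l"
  shows "(mat_adjoint P * Q) $$ (i, j) = col Q j \<bullet>c col P i"
  using assms by (auto simp: scalar_prod_def mat_adjoint_index intro!: sum.cong)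

text \<open>Gram-Schmidt on a basis completion of \<open>v\<close>, followed by normalisation. The
  scalar \<open>c\<close> stays unspecified because the deflation in
  \<open>hermitian_eigenbasis\<close> only uses the direction of the first column.\<close>

lemma unitary_with_first_col:
  assumes v: "v \<in> carrier_vec n" and v0: "v \<noteq> 0\<^sub>v n"
  obtains W c where "unitary_mat n W" "col W 0 = c \<cdot>\<^sub>v v"
proof -
  interpret cof_vec_space n "TYPE(complex)" .
  define ws where "ws = gram_schmidt n (basis_completion v)"
  note bc = basis_completion[OF v v0]
  have n: "n \<noteq> 0" using v v0 by (cases n) auto
  have ws: "set ws \<subseteq> carrier_vec n" "corthogonal ws" "length ws = n"
    using gram_schmidt_result[OF bc(2,4,5) refl] bc(6) by (auto simp: ws_def)
  obtain vs where "basis_completion v = v # vs"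
    using bc(6,7) n by (cases "basis_completion v") auto
  hence "hd ws = v" using gram_schmidt_hd[OF v, of vs] by (simp add: ws_def)
  hence ws0: "ws ! 0 = v" using ws(3) n by (cases ws) auto
  define g where "g u = complex_of_real (1 / norm2_vec u) \<cdot>\<^sub>v u" for u
  define W where "W = mat_of_cols n (map g ws)"
  have wsc: "ws ! i \<in> carrier_vec n" if "i < n" for i using ws that by auto
  have W: "W \<in> carrier_mat n n"
    using mat_of_cols_carrier(1)[of n "map g ws"] ws(3) by (simp add: W_def)
  have colW: "col W i = g (ws ! i)" if "i < n" for i
    using that ws(3) wsc[OF that] by (simp add: W_def g_def)
  have gg: "g (ws ! j) \<bullet>c g (ws ! i) = (if i = j then 1 else 0)" if "i < n" "j < n" for i j
  proof -
    have "ws ! i \<bullet>c ws ! i \<noteq> 0" using corthogonalD[OF ws(2)] that ws(3) by auto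
    hence "norm2_vec (ws ! i) \<noteq> 0" unfolding cscalar_prod_self by simp
    moreover have "g (ws ! j) \<bullet>c g (ws ! i) =
        complex_of_real (1 / norm2_vec (ws ! j) * (1 / norm2_vec (ws ! i))) * (ws ! j \<bullet>c ws ! i)"
      using wsc[OF that(1)] wsc[OF that(2)] unfolding g_def
      by (simp add: cscalar_prod_smult_left cscalar_prod_smult_right del: scalar_prod_smult_left scalar_prod_smult_right)
    ultimately show ?thesis
      using corthogonalD[OF ws(2), of j i] that ws(3)
      by (auto simp: cscalar_prod_self power2_eq_square)
  qed
  have "mat_adjoint W * W = 1\<^sub>m n"
  proof (rule eq_matI)
    fix i j assume "i < dim_row (1\<^sub>m n :: complex mat)" "j < dim_col (1\<^sub>m n :: complex mat)"
    hence ij: "i < n" "j < n" by auto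
    show "(mat_adjoint W * W) $$ (i, j) = 1\<^sub>m n $$ (i, j)"
      unfolding adjoint_mult_index[OF W W ij] using ij by (simp add: colW gg)
  qed (use W in auto)
  moreover have "col W 0 = complex_of_real (1 / norm2_vec v) \<cdot>\<^sub>v v"
    using colW[of 0] n by (simp add: ws0 g_def)
  ultimately show thesis using that unitary_matI[OF W] by blast
qed

section \<open>Spectral theorem for Hermitian matrices\<close>

lemma hermitian_eigenvalue_real:
  assumes A: "A \<in> carrier_mat n n" "hermitian_mat A"
    and v: "v \<in> carrier_vec n" "v \<noteq> 0\<^sub>v n" and ev: "A *\<^sub>v v = e \<cdot>\<^sub>v v"
  shows "e = complex_of_real (Re e)"
proof -
  have "e * (v \<bullet>c v) = cnj e * (v \<bullet>c v)"
    using hermitian_cscalar_prod[OF A v(1) v(1)] unfolding ev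
    by (simp add: cscalar_prod_smult_right cscalar_prod_smult_left)
  moreover have "v \<bullet>c v \<noteq> 0" using v by simp
  ultimately have "e = cnj e" by simp
  thus ?thesis by (simp add: complex_eq_iff)
qed

text \<open>Deflation, by induction on the dimension: in a unitary basis \<open>W\<close> starting
  with an eigenvector, the remaining block \<open>C\<close> is again Hermitian. Eigenvectors of
  \<open>C\<close> are padded with a leading 0 and mapped back by \<open>W\<close>.\<close>

lemma hermitian_eigenbasis:
  assumes "A \<in> carrier_mat n n" "hermitian_mat A"
  shows "\<exists>u (d :: nat \<Rightarrow> real). (\<forall>i<n. u i \<in> carrier_vec n \<and> A *\<^sub>v u i = complex_of_real (d i) \<cdot>\<^sub>v u i) \<and>
           (\<forall>i<n. \<forall>j<n. u i \<bullet>c u j = (if i = j then 1 else 0))"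
  using assms
proof (induction n arbitrary: A)
  case 0
  show ?case by simp
next
  case (Suc n A)
  note A = Suc.prems
  obtain e where "eigenvalue A e"
    using spectrum_non_empty[OF A(1)] by (auto simp: spectrum_def)
  then obtain v where v: "v \<in> carrier_vec (Suc n)" "v \<noteq> 0\<^sub>v (Suc n)" and ev: "A *\<^sub>v v = e \<cdot>\<^sub>v v"
    using A(1) by (auto simp: eigenvalue_def eigenvector_def)
  obtain W c where W: "unitary_mat (Suc n) W" and W0: "col W 0 = c \<cdot>\<^sub>v v"
    using unitary_with_first_col[OF v] .
  have Wc: "W \<in> carrier_mat (Suc n) (Suc n)" and WW: "mat_adjoint W * W = 1\<^sub>m (Suc n)"
    and WW': "W * mat_adjoint W = 1\<^sub>m (Suc n)" using W by (auto simp: unitary_mat_def)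
  note Wc' = mat_adjoint_carrier[OF Wc]
  define w where "w = col W"
  have wc: "w i \<in> carrier_vec (Suc n)" for i using Wc by (auto simp: w_def intro!: carrier_vecI)
  have ww: "w i \<bullet>c w j = (if i = j then 1 else 0)" if "i < Suc n" "j < Suc n" for i j
    using adjoint_mult_index[OF Wc Wc that(2,1)] that by (auto simp: WW w_def)
  have Aw0: "A *\<^sub>v w 0 = e \<cdot>\<^sub>v w 0"
    unfolding w_def W0 using A(1) v(1) by (simp add: mult_mat_vec ev smult_smult_assoc mult.commute)
  define A' where "A' = mat_adjoint W * (A * W)"
  have A'c: "A' \<in> carrier_mat (Suc n) (Suc n)" unfolding A'_def using A(1) Wc Wc' by auto
  have A'i: "A' $$ (i, j) = (A *\<^sub>v w j) \<bullet>c w i" if "i < Suc n" "j < Suc n" for i j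
  proof -
    have "col (A * W) j = A *\<^sub>v w j" using A(1) Wc that unfolding w_def by (intro eq_vecI) auto
    thus ?thesis unfolding A'_def using adjoint_mult_index[OF Wc mult_carrier_mat[OF A(1) Wc] that]
      by (simp add: w_def)
  qed
  \<comment> \<open>Knowing the first row suffices: the first column of \<open>A'\<close> only ever
    meets the leading 0 of \<open>vCons 0 x\<close>.\<close>
  have A'0: "A' $$ (0, Suc j) = 0" if "j < n" for j
    using that ww[of "Suc j" 0] wc
    by (simp add: A'i hermitian_cscalar_prod[OF A wc wc] Aw0 cscalar_prod_smult_right carrier_vecD[OF wc])
  define C where "C = mat n n (\<lambda>(i, j). A' $$ (Suc i, Suc j))"
  have Cc: "C \<in> carrier_mat n n" by (simp add: C_def)
  have Ci: "C $$ (i, j) = A' $$ (Suc i, Suc j)" if "i < n" "j < n" for i j using that by (simp add: C_def)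
  have A'h: "cnj (A' $$ (j, i)) = A' $$ (i, j)" if "i < Suc n" "j < Suc n" for i j
  proof -
    have "cnj (A' $$ (j, i)) = w j \<bullet>c (A *\<^sub>v w i)"
      using that cscalar_prod_swap[of "A *\<^sub>v w i" "Suc n" "w j"] wc A(1) by (simp add: A'i)
    thus ?thesis using that hermitian_cscalar_prod[OF A wc wc] by (simp add: A'i)
  qed
  have Ch: "hermitian_mat C"
    unfolding hermitian_mat_def
    by (rule eq_matI) (auto simp: mat_adjoint_index C_def A'h)
  obtain u d where u: "\<And>i. i < n \<Longrightarrow> u i \<in> carrier_vec n"
      "\<And>i. i < n \<Longrightarrow> C *\<^sub>v u i = complex_of_real (d i) \<cdot>\<^sub>v u i"
      "\<And>i j. i < n \<Longrightarrow> j < n \<Longrightarrow> u i \<bullet>c u j = (if i = j then 1 else 0)"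
    using Suc.IH[OF Cc Ch] by blast
  have A'v: "A' *\<^sub>v vCons 0 x = vCons 0 (C *\<^sub>v x)" if x: "x \<in> carrier_vec n" for x
  proof (rule eq_vecI)
    fix i assume "i < dim_vec (vCons 0 (C *\<^sub>v x))"
    hence i: "i < Suc n" by (simp add: C_def)
    have x': "vCons 0 x \<in> carrier_vec (Suc n)" using x by simp
    show "(A' *\<^sub>v vCons 0 x) $ i = vCons 0 (C *\<^sub>v x) $ i"
      unfolding mult_mat_vec_sum[OF A'c x' i] sum.lessThan_Suc_shift
      using i by (cases i) (auto simp: A'0 Ci mult_mat_vec_sum[OF Cc x] simp del: index_mult_mat_vec)
  qed (use A'c in \<open>auto simp: C_def\<close>)
  define u' where "u' i = (case i of 0 \<Rightarrow> w 0 | Suc j \<Rightarrow> W *\<^sub>v vCons 0 (u j))" for i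
  define d' where "d' i = (case i of 0 \<Rightarrow> Re e | Suc j \<Rightarrow> d j)" for i
  have x0: "vCons 0 (u j) \<in> carrier_vec (Suc n)" if "j < n" for j using u(1)[OF that] by simp
  have uc': "u' i \<in> carrier_vec (Suc n)" if "i < Suc n" for i
    using that wc Wc x0 by (cases i) (auto simp: u'_def intro: mult_mat_vec_carrier)
  have adj: "mat_adjoint W *\<^sub>v (W *\<^sub>v x) = x" if "x \<in> carrier_vec (Suc n)" for x
    using that assoc_mult_mat_vec[OF Wc' Wc that] WW by simp
  have eig: "A *\<^sub>v u' i = complex_of_real (d' i) \<cdot>\<^sub>v u' i" if i: "i < Suc n" for i
  proof (cases i)
    case 0
    have "e = complex_of_real (Re e)" by (rule hermitian_eigenvalue_real[OF A v ev])
    thus ?thesis using Aw0 0 by (simp add: u'_def d'_def)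
  next
    case (Suc j)
    hence j: "j < n" using i by simp
    note xj = x0[OF j]
    \<comment> \<open>Inserting the identity \<open>W * mat_adjoint W\<close> exposes
      \<open>A'\<close> acting on the padded vector.\<close>
    have "A *\<^sub>v u' i = (W * mat_adjoint W) *\<^sub>v (A *\<^sub>v (W *\<^sub>v vCons 0 (u j)))"
      unfolding WW' using A(1) Wc xj Suc by (auto simp: u'_def intro: mult_mat_vec_carrier)
    also have "\<dots> = W *\<^sub>v (mat_adjoint W *\<^sub>v (A *\<^sub>v (W *\<^sub>v vCons 0 (u j))))"
      by (rule assoc_mult_mat_vec[OF Wc Wc']) (use A(1) Wc xj in \<open>auto intro: mult_mat_vec_carrier\<close>)
    also have "mat_adjoint W *\<^sub>v (A *\<^sub>v (W *\<^sub>v vCons 0 (u j))) = A' *\<^sub>v vCons 0 (u j)"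
      unfolding A'_def using A(1) Wc Wc' xj 
      by (simp add: assoc_mult_mat_vec[OF Wc' mult_carrier_mat[OF A(1) Wc] xj] assoc_mult_mat_vec[OF A(1) Wc xj])
    also have "\<dots> = complex_of_real (d j) \<cdot>\<^sub>v vCons 0 (u j)"
      using A'v[OF u(1)[OF j]] u(1)[OF j] by (intro eq_vecI) (auto simp: u(2)[OF j] vec_index_vCons)
    also have "W *\<^sub>v \<dots> = complex_of_real (d' i) \<cdot>\<^sub>v u' i"
      using mult_mat_vec[OF Wc xj] Suc by (simp add: u'_def d'_def)
    finally show ?thesis .
  qed
  have orth: "u' i \<bullet>c u' j = (if i = j then 1 else 0)" if ij: "i < Suc n" "j < Suc n" for i j
  proof -
    have e0: "w 0 = W *\<^sub>v unit_vec (Suc n) 0" unfolding w_def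
      using Wc by (intro eq_vecI) auto
    \<comment> \<open>\<open>g i\<close> holds the coordinates of \<open>u' i\<close> in the basis
      \<open>W\<close>. As \<open>W\<close> is unitary, orthonormality may be checked on these
      coordinates.\<close>
    define g where "g i = (case i of 0 \<Rightarrow> unit_vec (Suc n) 0 | Suc j \<Rightarrow> vCons 0 (u j))" for i :: nat
    have g: "u' i = W *\<^sub>v g i" for i by (cases i) (auto simp: u'_def g_def e0)
    have gc: "g i \<in> carrier_vec (Suc n)" if "i < Suc n" for i using that x0 by (cases i) (auto simp: g_def)
    have "u' i \<bullet>c u' j = g i \<bullet>c g j"
      unfolding g using ij gc Wc
      by (subst cscalar_prod_adjoint[OF Wc]) (auto simp: adj intro: mult_mat_vec_carrier)
    moreover have "unit_vec (Suc n) 0 = vCons 1 (0\<^sub>v n :: complex vec)"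
      by (intro eq_vecI) (auto simp: vec_index_vCons)
    ultimately show ?thesis using ij u
      by (cases i; cases j) (auto simp: g_def)
  qed
  show ?case using uc' eig orth by blast
qed

lemma hermitian_eigendecomposition:
  assumes A: "A \<in> carrier_mat n n" "hermitian_mat A"
  obtains U d where "eigendecomposition A U (\<lambda>i. complex_of_real (d i))"
proof -
  obtain u d where u: "\<And>i. i < n \<Longrightarrow> u i \<in> carrier_vec n"
      "\<And>i. i < n \<Longrightarrow> A *\<^sub>v u i = complex_of_real (d i) \<cdot>\<^sub>v u i"
      "\<And>i j. i < n \<Longrightarrow> j < n \<Longrightarrow> u i \<bullet>c u j = (if i = j then 1 else 0)"
    using hermitian_eigenbasis[OF A] by blast
  define U where "U = mat_of_cols n (map u [0..<n])"
  have U: "U \<in> carrier_mat n n" by (simp add: U_def mat_of_cols_carrier(1)[of n "map u [0..<n]", simplified])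
  have colU: "col U i = u i" if "i < n" for i using that u(1) by (simp add: U_def)
  have "mat_adjoint U * U = 1\<^sub>m n"
  proof (rule eq_matI)
    fix i j assume "i < dim_row (1\<^sub>m n :: complex mat)" "j < dim_col (1\<^sub>m n :: complex mat)"
    hence ij: "i < n" "j < n" by auto
    show "(mat_adjoint U * U) $$ (i, j) = 1\<^sub>m n $$ (i, j)"
      unfolding adjoint_mult_index[OF U U ij] using ij by (simp add: colU u)
  qed (use U in auto)
  hence un: "unitary_mat n U" by (rule unitary_matI[OF U])
  let ?D = "mat_diag n (\<lambda>i. complex_of_real (d i))"
  have "A * U = U * ?D"
  proof (rule eq_matI)
    fix i j assume "i < dim_row (U * ?D)" "j < dim_col (U * ?D)"
    hence ij: "i < n" "j < n" using U by (auto simp: mat_diag_def)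
    have "(A * U) $$ (i, j) = (A *\<^sub>v u j) $ i" using A(1) U ij colU by simp
    also have "\<dots> = (U * ?D) $$ (i, j)"
      using ij u(1) U unfolding u(2)[OF ij(2)] mat_diag_mult_right[OF U]
      by (simp add: colU[symmetric] del: col_mat_of_cols)
    finally show "(A * U) $$ (i, j) = (U * ?D) $$ (i, j)" .
  qed (use A(1) U in \<open>auto simp: mat_diag_def\<close>)
  hence "U * ?D * mat_adjoint U = A * (U * mat_adjoint U)"
    using A(1) U mat_adjoint_carrier[OF U] by (metis assoc_mult_mat)
  hence "A = U * ?D * mat_adjoint U" using un A(1) by (simp add: unitary_mat_def)
  thus thesis using that un A(1) by (auto simp: eigendecomposition_def)
qed

subsection \<open>Matrix functions, resolvents and Rayleigh quotients\<close>

lemma eigendecompositionD: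
  assumes "eigendecomposition A U d" "A \<in> carrier_mat n n"
  shows "U \<in> carrier_mat n n" "mat_adjoint U \<in> carrier_mat n n"
    "mat_adjoint U * U = 1\<^sub>m n" "U * mat_adjoint U = 1\<^sub>m n"
    "A = U * mat_diag n d * mat_adjoint U"
    "mat_fun f A = U * mat_diag n (\<lambda>i. f (d i)) * mat_adjoint U"
    "mat_fun f A \<in> carrier_mat n n"
proof -
  have [simp]: "dim_row A = n" using assms(2) by simp
  show U: "U \<in> carrier_mat n n" and "mat_adjoint U * U = 1\<^sub>m n" "U * mat_adjoint U = 1\<^sub>m n"
    using assms(1) by (auto simp: eigendecomposition_def unitary_mat_def)
  show U': "mat_adjoint U \<in> carrier_mat n n" by (rule mat_adjoint_carrier[OF U])
  show "A = U * mat_diag n d * mat_adjoint U"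
    using assms(1) unfolding eigendecomposition_def by simp
  show e: "mat_fun f A = U * mat_diag n (\<lambda>i. f (d i)) * mat_adjoint U"
    using mat_fun_eq[OF assms(1)] by simp
  show "mat_fun f A \<in> carrier_mat n n"
    unfolding e using U U' by (intro mult_carrier_mat[of _ n n]) auto
qed

lemma unitary_mult_vec:
  assumes "unitary_mat n U" "x \<in> carrier_vec n"
  shows "mat_adjoint U *\<^sub>v (U *\<^sub>v x) = x" "U *\<^sub>v (mat_adjoint U *\<^sub>v x) = x"
  using assms mat_adjoint_carrier[of U n n]
  by (simp_all add: unitary_mat_def assoc_mult_mat_vec[of _ n n _ n, symmetric])

lemma mat_diag_mult_vec:
  assumes "x \<in> carrier_vec n"
  shows "mat_diag n f *\<^sub>v x = vec n (\<lambda>i. f i * x $ i)"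
proof (rule eq_vecI)
  fix i assume "i < dim_vec (vec n (\<lambda>i. f i * x $ i))"
  hence i: "i < n" by simp
  have "(mat_diag n f *\<^sub>v x) $ i = (\<Sum>j<n. (if i = j then f j else 0) * x $ j)"
    unfolding mult_mat_vec_sum[OF mat_diag_dim assms i]
    using i by (intro sum.cong) (auto simp: mat_diag_def)
  also have "\<dots> = (\<Sum>j<n. if i = j then f j * x $ j else 0)"
    by (intro sum.cong) auto
  finally show "(mat_diag n f *\<^sub>v x) $ i = vec n (\<lambda>i. f i * x $ i) $ i"
    using i by simp
qed (simp add: mat_diag_def)

lemma mat_fun_mult_vec:
  assumes E: "eigendecomposition A U d" and A: "A \<in> carrier_mat n n" and x: "x \<in> carrier_vec n"
  shows "mat_fun f A *\<^sub>v x = U *\<^sub>v vec n (\<lambda>i. f (d i) * (mat_adjoint U *\<^sub>v x) $ i)"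
proof -
  note D = eigendecompositionD[OF E A]
  have Ux: "mat_adjoint U *\<^sub>v x \<in> carrier_vec n" using D(2) x by (rule mult_mat_vec_carrier)
  have "mat_fun f A *\<^sub>v x = U *\<^sub>v (mat_diag n (\<lambda>i. f (d i)) *\<^sub>v (mat_adjoint U *\<^sub>v x))"
    unfolding D(6) using D(1,2) x
    by (simp add: assoc_mult_mat_vec[OF mult_carrier_mat[OF D(1) mat_diag_dim] D(2) x]
        assoc_mult_mat_vec[OF D(1) mat_diag_dim Ux])
  thus ?thesis unfolding mat_diag_mult_vec[OF Ux] .
qed

text \<open>In eigenbasis coordinates a matrix function is a pointwise multiplication, which lets
  the error be studied one eigenvalue at a time.\<close>

lemma mat_fun_coord:
  assumes E: "eigendecomposition A U d" and A: "A \<in> carrier_mat n n" and x: "x \<in> carrier_vec n"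
    and i: "i < n"
  shows "(mat_adjoint U *\<^sub>v (mat_fun f A *\<^sub>v x)) $ i = f (d i) * (mat_adjoint U *\<^sub>v x) $ i"
proof -
  have "unitary_mat n U" using E A by (auto simp: eigendecomposition_def)
  thus ?thesis unfolding mat_fun_mult_vec[OF E A x] using i by (simp add: unitary_mult_vec)
qed

lemma mat_fun_mult:
  assumes E: "eigendecomposition A U d" and A: "A \<in> carrier_mat n n"
  shows "mat_fun f A * mat_fun g A = mat_fun (\<lambda>x. f x * g x) A"
proof -
  note D = eigendecompositionD[OF E A]
  let ?F = "mat_diag n (\<lambda>i. f (d i))" and ?G = "mat_diag n (\<lambda>i. g (d i))"
  have mc: "X * Y \<in> carrier_mat n n" if "X \<in> carrier_mat n n" "Y \<in> carrier_mat n n"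
    for X Y :: "complex mat"
    using that by (rule mult_carrier_mat)
  have asc: "(X * Y) * Z = X * (Y * Z)"
    if "X \<in> carrier_mat n n" "Y \<in> carrier_mat n n" "Z \<in> carrier_mat n n"
    for X Y Z :: "complex mat"
    using that by (rule assoc_mult_mat)
  have "(U * ?F * mat_adjoint U) * (U * ?G * mat_adjoint U) =
      U * (?F * ((mat_adjoint U * U) * (?G * mat_adjoint U)))"
    using D(1,2) by (simp add: asc mc del: mat_diag_diag)
  also have "\<dots> = U * ((?F * ?G) * mat_adjoint U)"
    unfolding D(3) using D(1,2) by (simp add: asc mc left_mult_one_mat[OF mc] del: mat_diag_diag)
  also have "\<dots> = U * (?F * ?G) * mat_adjoint U"
    using D(1,2) by (simp add: asc mc)
  finally show ?thesis by (simp add: D(6))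
qed

lemma mat_fun_id:
  assumes "eigendecomposition A U d" "A \<in> carrier_mat n n"
  shows "mat_fun (\<lambda>x. x) A = A"
  by (rule trans[OF eigendecompositionD(6)[OF assms] eigendecompositionD(5)[OF assms, symmetric]])

lemma mat_fun_one:
  assumes "eigendecomposition A U d" "A \<in> carrier_mat n n"
  shows "mat_fun (\<lambda>x. 1) A = 1\<^sub>m n"
  using eigendecompositionD(1,2,4)[OF assms] by (simp add: eigendecompositionD(6)[OF assms])

lemma mat_fun_shift:
  assumes E: "eigendecomposition A U d" and A: "A \<in> carrier_mat n n"
  shows "mat_fun (\<lambda>x. x - w) A = A - w \<cdot>\<^sub>m 1\<^sub>m n"
proof -
  note D = eigendecompositionD[OF E A]
  have "mat_diag n (\<lambda>i. d i - w) = mat_diag n d - w \<cdot>\<^sub>m 1\<^sub>m n"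
    by (rule eq_matI) (auto simp: mat_diag_def)
  moreover have "U * (mat_diag n d - w \<cdot>\<^sub>m 1\<^sub>m n) * mat_adjoint U = A - w \<cdot>\<^sub>m 1\<^sub>m n"
  proof -
    have "U * (mat_diag n d - w \<cdot>\<^sub>m 1\<^sub>m n) = U * mat_diag n d - w \<cdot>\<^sub>m U"
      using D(1) by (simp add: mult_minus_distrib_mat[of _ n n _ n] mult_smult_distrib[of _ n n _ n])
    also have "\<dots> * mat_adjoint U = U * mat_diag n d * mat_adjoint U - w \<cdot>\<^sub>m (U * mat_adjoint U)"
      using D(1,2) mult_carrier_mat[OF D(1) mat_diag_dim]
      by (simp add: minus_mult_distrib_mat[of _ n n _ _ n] mult_smult_assoc_mat[of _ n n _ n])
    finally show ?thesis unfolding D(4) D(5)[symmetric] .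
  qed
  ultimately show ?thesis by (simp add: D(6))
qed

text \<open>The matrix function is a two-sided inverse of the shifted matrix, so
  \<open>mat_inverse\<close> cannot return \<open>None\<close>, and inverses are unique.\<close>

lemma resolvent_eq_mat_fun:
  assumes E: "eigendecomposition A U d" and A: "A \<in> carrier_mat n n"
    and w: "\<And>i. i < n \<Longrightarrow> d i \<noteq> w"
  shows "resolvent A w = mat_fun (\<lambda>x. 1 / (x - w)) A"
proof -
  note D = eigendecompositionD[OF E A]
  let ?B = "A - w \<cdot>\<^sub>m 1\<^sub>m n" and ?R = "mat_fun (\<lambda>x. 1 / (x - w)) A"
  have B: "?B \<in> carrier_mat n n" by (intro minus_carrier_mat smult_carrier_mat one_carrier_mat)
  \<comment> \<open>Asking for the value 1 only at the eigenvalues is essential: the product of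
    \<open>x - w\<close> and \<open>1 / (x - w)\<close> is 0 at \<open>x = w\<close>.\<close>
  have one: "mat_fun g A = 1\<^sub>m n" if "\<And>i. i < n \<Longrightarrow> g (d i) = 1" for g
  proof -
    have "mat_diag n (\<lambda>i. g (d i)) = mat_diag n (\<lambda>i. 1)"
      using that by (intro eq_matI) (auto simp: mat_diag_def)
    thus ?thesis using D(1,2,4) by (simp add: D(6))
  qed
  have RB: "?R * ?B = 1\<^sub>m n" "?B * ?R = 1\<^sub>m n"
    unfolding mat_fun_shift[OF E A, symmetric] mat_fun_mult[OF E A]
    by (rule one; use w in simp)+
  have "mat_inverse ?B \<noteq> None"
  proof
    assume "mat_inverse ?B = None"
    from mat_inverse(1)[OF B this, of undefined] have "?B \<notin> Units (ring_mat TYPE(complex) n undefined)" .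
    moreover have "?R \<in> carrier_mat n n" by (rule D(7))
    ultimately show False using RB B unfolding Units_def ring_mat_simps by blast
  qed
  then obtain C where C: "mat_inverse ?B = Some C" by auto
  note C' = mat_inverse(2)[OF B C]
  have "C = (?R * ?B) * C" unfolding RB using C' left_mult_one_mat[of C n n] by simp
  also have "\<dots> = ?R * (?B * C)" using C' B D(7) by (intro assoc_mult_mat[of _ n n _ n _ n]) auto
  also have "\<dots> = ?R" using C' right_mult_one_mat[OF D(7)] by simp
  finally show ?thesis using A C by (simp add: resolvent_def)
qed

lemma eigendecomposition_col:
  assumes E: "eigendecomposition A U d" and A: "A \<in> carrier_mat n n" and i: "i < n"
  shows "A *\<^sub>v col U i = d i \<cdot>\<^sub>v col U i" "col U i \<bullet>c col U i = 1"
    "col U i \<in> carrier_vec n"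
proof -
  note D = eigendecompositionD[OF E A]
  show c: "col U i \<in> carrier_vec n" using D(1) by (intro carrier_vecI) simp
  show "col U i \<bullet>c col U i = 1"
    using adjoint_mult_index[OF D(1,1) i i] D(3) i by simp
  have "A * U = U * mat_diag n d * (mat_adjoint U * U)"
    using assoc_mult_mat[OF mult_carrier_mat[OF D(1) mat_diag_dim[of n d]] D(2) D(1)]
    by (simp only: D(5)[symmetric])
  also have "\<dots> = U * mat_diag n d"
    unfolding D(3) by (rule right_mult_one_mat[OF mult_carrier_mat[OF D(1) mat_diag_dim]])
  also have "\<dots> = Matrix.mat n n (\<lambda>(i, j). U $$ (i, j) * d j)"
    by (rule mat_diag_mult_right[OF D(1)])
  finally have AU: "A * U = Matrix.mat n n (\<lambda>(i, j). U $$ (i, j) * d j)" .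
  show "A *\<^sub>v col U i = d i \<cdot>\<^sub>v col U i"
  proof (rule eq_vecI)
    fix l assume "l < dim_vec (d i \<cdot>\<^sub>v col U i)"
    hence l: "l < n" using D(1) by simp
    have "(A *\<^sub>v col U i) $ l = (A * U) $$ (l, i)" using A D(1) i l by simp
    also have "\<dots> = U $$ (l, i) * d i" unfolding AU using i l by simp
    also have "\<dots> = (d i \<cdot>\<^sub>v col U i) $ l" using l i D(1) by simp
    finally show "(A *\<^sub>v col U i) $ l = (d i \<cdot>\<^sub>v col U i) $ l" .
  qed (use A D(1) in auto)
qed

section \<open>Location of eigenvalues and Ritz values\<close>

lemma eigendecomposition_spectrum:
  assumes E: "eigendecomposition A U d" and A: "A \<in> carrier_mat n n" and i: "i < n"
  shows "d i \<in> spectrum A"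
proof -
  note C = eigendecomposition_col[OF assms]
  have "col U i \<noteq> 0\<^sub>v n" using C(2,3) conjugate_square_eq_0_vec[of "col U i" n] by auto
  thus ?thesis using C A by (auto simp: spectrum_def eigenvalue_def eigenvector_def)
qed

lemma eigendecomposition_lambda_bounds:
  assumes E: "eigendecomposition A U d" and A: "A \<in> carrier_mat n n" and i: "i < n"
  shows "lambda_min A \<le> Re (d i)" "Re (d i) \<le> lambda_max A"
  using eigendecomposition_spectrum[OF assms] card_finite_spectrum(1)[OF A]
  by (auto simp: lambda_min_def lambda_max_def)

text \<open>The squared moduli of the eigenbasis coordinates of a unit vector sum to 1, so the
  Rayleigh quotient is a convex combination of eigenvalues.\<close>

lemma rayleigh_bounds:
  assumes A: "A \<in> carrier_mat n n" "hermitian_mat A" and x: "x \<in> carrier_vec n" and x1: "x \<bullet>c x = 1"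
  shows "lambda_min A \<le> Re ((A *\<^sub>v x) \<bullet>c x)" "Re ((A *\<^sub>v x) \<bullet>c x) \<le> lambda_max A"
proof -
  obtain U d where E: "eigendecomposition A U (\<lambda>i. complex_of_real (d i))"
    using hermitian_eigendecomposition[OF A] .
  note D = eigendecompositionD[OF E A(1)]
  have un: "unitary_mat n U" using E A by (auto simp: eigendecomposition_def)
  define y where "y = mat_adjoint U *\<^sub>v x"
  have y: "y \<in> carrier_vec n" unfolding y_def using D(2) x by (rule mult_mat_vec_carrier)
  have xy: "x = U *\<^sub>v y" unfolding y_def using unitary_mult_vec[OF un x] by simp
  have "y \<bullet>c y = 1"
    using x1 cscalar_prod_adjoint[OF D(1) y x] unfolding xy[symmetric] y_def[symmetric] by simp
  hence "(\<Sum>i<n. complex_of_real ((cmod (y $ i))\<^sup>2)) = 1"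
    using y by (simp only: cscalar_prod_sum complex_norm_square)
  hence y1: "(\<Sum>i<n. (cmod (y $ i))\<^sup>2) = 1"
    by (metis of_real_eq_1_iff of_real_sum)
  have "A *\<^sub>v x = U *\<^sub>v vec n (\<lambda>i. complex_of_real (d i) * y $ i)"
    using mat_fun_mult_vec[OF E A(1) x, of "\<lambda>x. x"] by (simp add: mat_fun_id[OF E A(1)] y_def)
  hence "(A *\<^sub>v x) \<bullet>c x = vec n (\<lambda>i. complex_of_real (d i) * y $ i) \<bullet>c y"
    using cscalar_prod_adjoint[OF D(1) _ x, of "vec n (\<lambda>i. complex_of_real (d i) * y $ i)"] by (simp add: y_def)
  also have "\<dots> = (\<Sum>i<n. complex_of_real (d i * (cmod (y $ i))\<^sup>2))"
    unfolding cscalar_prod_sum[OF y] of_real_mult complex_norm_square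
    by (intro sum.cong) (auto simp: mult.assoc)
  finally have R: "Re ((A *\<^sub>v x) \<bullet>c x) = (\<Sum>i<n. d i * (cmod (y $ i))\<^sup>2)" by simp
  have b: "lambda_min A \<le> d i" "d i \<le> lambda_max A" if "i < n" for i
    using eigendecomposition_lambda_bounds[OF E A(1) that] by auto
  have "lambda_min A = (\<Sum>i<n. lambda_min A * (cmod (y $ i))\<^sup>2)"
    by (simp add: sum_distrib_left[symmetric] y1)
  also have "\<dots> \<le> Re ((A *\<^sub>v x) \<bullet>c x)" unfolding R
    by (intro sum_mono mult_right_mono) (auto simp: b)
  finally show "lambda_min A \<le> Re ((A *\<^sub>v x) \<bullet>c x)" .
  have "Re ((A *\<^sub>v x) \<bullet>c x) \<le> (\<Sum>i<n. lambda_max A * (cmod (y $ i))\<^sup>2)" unfolding R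
    by (intro sum_mono mult_right_mono) (auto simp: b)
  also have "\<dots> = lambda_max A" by (simp add: sum_distrib_left[symmetric] y1)
  finally show "Re ((A *\<^sub>v x) \<bullet>c x) \<le> lambda_max A" .
qed

text \<open>A unit eigenvector \<open>v\<close> of the compression gives a unit vector
  \<open>Q *\<^sub>v v\<close> at which the Rayleigh quotient of \<open>A\<close> equals the
  eigenvalue. This keeps the eigenvalues of the Lanczos matrix above \<open>w\<close> and inside the
  disk.\<close>

lemma compression_eigenvalue_bounds:
  assumes A: "A \<in> carrier_mat n n" "hermitian_mat A" and Q: "Q \<in> carrier_mat n k"
    and QQ: "mat_adjoint Q * Q = 1\<^sub>m k" and T: "mat_adjoint Q * (A * Q) = T"
    and E: "eigendecomposition T V \<theta>" and j: "j < k"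
  shows "lambda_min A \<le> Re (\<theta> j)" "Re (\<theta> j) \<le> lambda_max A"
proof -
  note Q' = mat_adjoint_carrier[OF Q]
  have Tc: "T \<in> carrier_mat k k" using A(1) Q Q' by (auto simp: T[symmetric])
  define v where "v = col V j"
  note C = eigendecomposition_col[OF E Tc j, folded v_def]
  define x where "x = Q *\<^sub>v v"
  have x: "x \<in> carrier_vec n" unfolding x_def using Q C(3) by (rule mult_mat_vec_carrier)
  have "x \<bullet>c x = 1"
    using cscalar_prod_adjoint[OF Q C(3) x] C assoc_mult_mat_vec[OF Q' Q C(3)]
    by (simp add: x_def[symmetric] QQ)
  moreover have "(A *\<^sub>v x) \<bullet>c x = \<theta> j"
  proof -
    have Ax: "A *\<^sub>v x \<in> carrier_vec n" using A(1) x by (rule mult_mat_vec_carrier)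
    have "mat_adjoint Q *\<^sub>v (A *\<^sub>v x) = T *\<^sub>v v"
      unfolding T[symmetric] x_def
      by (simp add: assoc_mult_mat_vec[OF Q' mult_carrier_mat[OF A(1) Q] C(3)] assoc_mult_mat_vec[OF A(1) Q C(3)])
    moreover have "(A *\<^sub>v x) \<bullet>c x = (mat_adjoint Q *\<^sub>v (A *\<^sub>v x)) \<bullet>c v"
      using cscalar_prod_adjoint[OF Q' Ax C(3)] by (simp add: x_def)
    ultimately show ?thesis using C by (simp add: cscalar_prod_smult_left)
  qed
  ultimately show "lambda_min A \<le> Re (\<theta> j)" "Re (\<theta> j) \<le> lambda_max A"
    using rayleigh_bounds[OF A x] by auto
qed

subsection \<open>Functionals vanishing on polynomials of low degree\<close>

text \<open>Linear extension from monomials. Here \<open>y\<close> and \<open>c j\<close> stand for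
  the weights of one error coordinate at the eigenvalue \<open>d\<close> and at the nodes
  \<open>\<theta> j\<close>.\<close>

lemma moment_matching_poly:
  fixes y d :: complex and c \<theta> :: "nat \<Rightarrow> complex"
  assumes mom: "\<And>m. m < k \<Longrightarrow> y * d ^ m = (\<Sum>j<k. c j * \<theta> j ^ m)"
    and p: "degree p < k"
  shows "y * poly p d = (\<Sum>j<k. c j * poly p (\<theta> j))"
proof -
  have "y * poly p d = (\<Sum>m\<le>degree p. coeff p m * (y * d ^ m))"
    by (simp add: poly_altdef sum_distrib_left mult_ac)
  also have "\<dots> = (\<Sum>m\<le>degree p. \<Sum>j<k. coeff p m * (c j * \<theta> j ^ m))"
    using p by (intro sum.cong) (auto simp: mom sum_distrib_left)
  also have "\<dots> = (\<Sum>j<k. \<Sum>m\<le>degree p. coeff p m * (c j * \<theta> j ^ m))"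
    by (rule sum.swap)
  also have "\<dots> = (\<Sum>j<k. c j * poly p (\<theta> j))"
    by (simp add: poly_altdef sum_distrib_left mult_ac)
  finally show ?thesis .
qed

text \<open>The quotient \<open>q\<close> of \<open>cp - cp(z)\<close> by \<open>x - z\<close> has
  degree below \<open>k\<close>, so moment matching applies to it. Since \<open>cp\<close> vanishes
  at every node, the sum over the nodes becomes a multiple of the sum of the resolvent
  terms.\<close>

lemma moment_matching_resolvent:
  fixes y d z :: complex and c \<theta> :: "nat \<Rightarrow> complex"
  assumes mom: "\<And>m. m < k \<Longrightarrow> y * d ^ m = (\<Sum>j<k. c j * \<theta> j ^ m)" and k: "k \<ge> 1"
    and zd: "z \<noteq> d" and z\<theta>: "\<And>j. j < k \<Longrightarrow> z \<noteq> \<theta> j"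
  shows "y / (d - z) - (\<Sum>j<k. c j / (\<theta> j - z)) =
    y * (\<Prod>j<k. d - \<theta> j) / ((\<Prod>j<k. z - \<theta> j) * (d - z))"
proof -
  define cp where "cp = (\<Prod>j<k. [:- \<theta> j, 1:])"
  have cpx: "poly cp x = (\<Prod>j<k. x - \<theta> j)" for x by (simp add: cp_def poly_prod)
  have deg: "degree cp = k" unfolding cp_def by (subst degree_prod_eq_sum_degree) auto
  have z0: "poly cp z \<noteq> 0" using z\<theta> by (auto simp: cpx)
  have "[:- z, 1:] dvd cp - [:poly cp z:]" by (simp add: poly_eq_0_iff_dvd[symmetric])
  then obtain q where q: "cp - [:poly cp z:] = [:- z, 1:] * q" by auto
  have "degree q < k"
  \<comment> \<open>The zero polynomial has degree 0 by convention, and \<open>k \<ge> 1\<close>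
    settles that case.\<close>
  proof (cases "q = 0")
    case False
    have "degree ([:- z, 1:] * q) = Suc (degree q)"
      using False by (subst degree_mult_eq) auto
    moreover have "degree (cp - [:poly cp z:]) \<le> k"
      using deg by (intro degree_diff_le) auto
    ultimately show ?thesis using q by simp
  qed (use k in auto)
  note m = moment_matching_poly[OF mom this]
  have qx: "poly q x = (poly cp x - poly cp z) / (x - z)" if "x \<noteq> z" for x
    using arg_cong[OF q, of "\<lambda>p. poly p x"] that by (simp add: field_simps)
  have "poly q (\<theta> j) = - poly cp z / (\<theta> j - z)" if "j < k" for j
  proof -
    have "poly cp (\<theta> j) = 0" using that by (auto simp: cpx)
    thus ?thesis using qx[of "\<theta> j"] z\<theta>[OF that] by auto
  qed
  hence "y * ((poly cp d - poly cp z) / (d - z)) = (\<Sum>j<k. - poly cp z * (c j / (\<theta> j - z)))"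
    using m zd by (simp add: qx mult.commute)
  also have "\<dots> = - poly cp z * (\<Sum>j<k. c j / (\<theta> j - z))" by (simp only: sum_distrib_left)
  finally have eq: "y * ((poly cp d - poly cp z) / (d - z)) = - poly cp z * (\<Sum>j<k. c j / (\<theta> j - z))" .
  \<comment> \<open>With the two values of \<open>cp\<close>, the reciprocal and the sum abstracted
    to variables, what remains is solving a linear equation for \<open>s\<close>.\<close>
  have "y * u - s = y * a * u / b" if "y * ((a - b) * u) = - b * s" "b \<noteq> 0" for a b s u :: complex
  proof -
    have "(y * u - s) * b = y * a * u" using that(1) by (simp add: algebra_simps)
    thus ?thesis using that(2) by (simp add: eq_divide_eq)
  qed
  from this[of "poly cp d" "poly cp z" "1 / (d - z)"] eq z0
  show ?thesis unfolding cpx[symmetric] by simp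
qed

subsection \<open>The Lanczos recurrence\<close>

text \<open>Connects powers defined through the eigendecomposition with iterated multiplication, the
  form in which Krylov vectors arise.\<close>

lemma mat_fun_power_mult_vec:
  assumes E: "eigendecomposition A U d" and A: "A \<in> carrier_mat n n" and x: "x \<in> carrier_vec n"
  shows "mat_fun (\<lambda>z. z ^ m) A *\<^sub>v x = ((\<lambda>v. A *\<^sub>v v) ^^ m) x"
proof (induction m)
  case 0
  show ?case using mat_fun_one[OF E A] x by simp
next
  case (Suc m)
  have "mat_fun (\<lambda>z. z ^ Suc m) A = A * mat_fun (\<lambda>z. z ^ m) A"
    using mat_fun_mult[OF E A, of "\<lambda>z. z" "\<lambda>z. z ^ m"] by (simp add: mat_fun_id[OF E A])
  thus ?case using Suc assoc_mult_mat_vec[OF A eigendecompositionD(7)[OF E A] x] by simp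
qed

locale lanczos_run =
  fixes A :: "complex mat" and b :: "complex vec" and n k :: nat
  assumes A_carrier: "A \<in> carrier_mat n n" and A_hermitian: "hermitian_mat A"
    and b_carrier: "b \<in> carrier_vec n"
    and no_breakdown: "lanczos_no_breakdown A b k"
begin

abbreviation "q \<equiv> lanczos_q A b"
abbreviation "\<alpha> \<equiv> lanczos_alpha A b"
abbreviation "\<beta> \<equiv> lanczos_beta A b"
abbreviation "r \<equiv> lanczos_r A b"
abbreviation "Q \<equiv> lanczos_Q A b k"
abbreviation "T \<equiv> lanczos_T A b k"

lemma q_carrier [simp]: "q j \<in> carrier_vec n"
proof -
  \<comment> \<open>The recurrence reaches back two indices, so the induction carries a pair of
    consecutive vectors.\<close>
  have "q j \<in> carrier_vec n \<and> q (Suc j) \<in> carrier_vec n"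
    using b_carrier A_carrier
    by (induction j) (auto intro!: smult_carrier_vec minus_carrier_vec mult_mat_vec_carrier)
  thus ?thesis ..
qed

lemma dim_q [simp]: "dim_vec (q j) = n"
  using q_carrier by (rule carrier_vecD)

lemma Aq_carrier [simp]: "A *\<^sub>v q j \<in> carrier_vec n"
  using A_carrier q_carrier by (rule mult_mat_vec_carrier)

lemma r_carrier [simp]: "r (Suc j) \<in> carrier_vec n"
  by (auto intro!: minus_carrier_vec smult_carrier_vec)

text \<open>If \<open>\<beta> (Suc j)\<close> is 0, the remainder is itself the zero vector and both
  sides vanish. The three-term recurrence therefore holds at every step, including one where the
  algorithm stops.\<close>

lemma r_eq: "r (Suc j) = complex_of_real (\<beta> (Suc j)) \<cdot>\<^sub>v q (Suc (Suc j))"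
proof (cases "\<beta> (Suc j) = 0")
  case True
  hence "r (Suc j) = 0\<^sub>v n" using norm2_vec_eq_0_iff[OF r_carrier] by simp
  thus ?thesis using True by auto
next
  case False
  thus ?thesis by (simp add: smult_smult_assoc del: lanczos_r.simps lanczos_beta.simps)
qed

lemma three_term_index:
  assumes "l < n"
  shows "(A *\<^sub>v q (Suc j)) $ l = complex_of_real (\<beta> j) * q j $ l + \<alpha> (Suc j) * q (Suc j) $ l
    + complex_of_real (\<beta> (Suc j)) * q (Suc (Suc j)) $ l"
proof -
  have "r (Suc j) $ l = (A *\<^sub>v q (Suc j)) $ l - complex_of_real (\<beta> j) * q j $ l - \<alpha> (Suc j) * q (Suc j) $ l"
    using assms A_carrier by (simp del: index_mult_mat_vec lanczos_alpha.simps lanczos_beta.simps lanczos_q.simps)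
  moreover have "r (Suc j) $ l = complex_of_real (\<beta> (Suc j)) * q (Suc (Suc j)) $ l"
    using assms unfolding r_eq by (simp del: lanczos_beta.simps lanczos_q.simps)
  ultimately show ?thesis by (simp del: lanczos_r.simps lanczos_alpha.simps lanczos_beta.simps lanczos_q.simps index_mult_mat_vec)
qed

lemma three_term_cscalar_prod:
  assumes y: "y \<in> carrier_vec n"
  shows "(A *\<^sub>v q (Suc j)) \<bullet>c y = complex_of_real (\<beta> j) * (q j \<bullet>c y) + \<alpha> (Suc j) * (q (Suc j) \<bullet>c y)
    + complex_of_real (\<beta> (Suc j)) * (q (Suc (Suc j)) \<bullet>c y)"
  using y by (simp add: cscalar_prod_sum three_term_index sum.distrib sum_distrib_left algebra_simps
      del: index_mult_mat_vec lanczos_alpha.simps lanczos_beta.simps lanczos_q.simps)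

lemma alpha_eq: "\<alpha> (Suc j) = (A *\<^sub>v q (Suc j)) \<bullet>c q (Suc j) - complex_of_real (\<beta> j) * (q j \<bullet>c q (Suc j))"
proof -
  have "\<alpha> (Suc j) = (A *\<^sub>v q (Suc j) - complex_of_real (\<beta> j) \<cdot>\<^sub>v q j) \<bullet>c q (Suc j)"
    by (simp del: lanczos_q.simps lanczos_beta.simps)
  also have "\<dots> = (A *\<^sub>v q (Suc j)) \<bullet>c q (Suc j) - (complex_of_real (\<beta> j) \<cdot>\<^sub>v q j) \<bullet>c q (Suc j)"
    by (rule minus_scalar_prod_distrib[of _ n]) auto
  finally show ?thesis by (simp del: lanczos_q.simps lanczos_beta.simps lanczos_alpha.simps)
qed

text \<open>Index 0 is included with inner products 0, as \<open>q 0\<close> is the zero vector. The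
  recurrence can then be used at its first step without a special case.\<close>

definition orthonormal_upto :: "nat \<Rightarrow> bool" where
  "orthonormal_upto m \<longleftrightarrow> (\<forall>i\<le>m. \<forall>j\<le>m. q i \<bullet>c q j = (if i = j \<and> i \<noteq> 0 then 1 else 0))"

lemma q0_cscalar_prod: "q 0 \<bullet>c q j = 0" "q j \<bullet>c q 0 = 0"
  using b_carrier by (auto simp: scalar_prod_left_zero[of _ n] scalar_prod_right_zero[of _ n] simp del: lanczos_q.simps(2,3))

text \<open>Keeping the factor \<open>\<beta> (Suc m)\<close> makes the statement valid even at a
  breakdown. Against \<open>q (Suc m)\<close> the choice of \<open>\<alpha>\<close> gives
  orthogonality; against earlier vectors \<open>A\<close> is moved to the other side and the
  recurrence is applied there.\<close>

lemma next_orthogonal: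
  assumes m: "orthonormal_upto (Suc m)" and i: "i \<le> Suc m"
  shows "complex_of_real (\<beta> (Suc m)) * (q (Suc (Suc m)) \<bullet>c q i) = 0"
proof (cases i)
  case 0
  thus ?thesis by (simp add: q0_cscalar_prod del: lanczos_beta.simps lanczos_q.simps)
next
  case (Suc i')
  have o: "q i \<bullet>c q j = (if i = j \<and> i \<noteq> 0 then 1 else 0)" if "i \<le> Suc m" "j \<le> Suc m" for i j
    using m that by (auto simp: orthonormal_upto_def)
  note [simp del] = lanczos_alpha.simps lanczos_beta.simps lanczos_q.simps
  note tt = three_term_cscalar_prod[OF q_carrier, of m i]
  show ?thesis
  proof (cases "i' = m")
    case True
    show ?thesis using tt alpha_eq[of m] o[of "Suc m" "Suc m"] unfolding Suc True by simp
  next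
    case False
    have "(A *\<^sub>v q (Suc m)) \<bullet>c q i = cnj ((A *\<^sub>v q i) \<bullet>c q (Suc m))"
      using hermitian_cscalar_prod[OF A_carrier A_hermitian q_carrier q_carrier]
        cscalar_prod_swap[OF Aq_carrier q_carrier] by simp
    \<comment> \<open>Of the three vectors in the expansion of \<open>A *\<^sub>v q i\<close>, at
      most \<open>q (Suc i)\<close> can equal \<open>q (Suc m)\<close>, which happens for
      \<open>i = m\<close>. This contribution later cancels the \<open>\<beta> m\<close> term of the
      recurrence at \<open>m\<close>.\<close>
    also have "(A *\<^sub>v q i) \<bullet>c q (Suc m) = complex_of_real (\<beta> m) * (if i' = m - 1 \<and> m \<noteq> 0 then 1 else 0)"
      using three_term_cscalar_prod[OF q_carrier, of i' "Suc m"] i False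
      unfolding Suc by (auto simp: o)
    finally have 1: "(A *\<^sub>v q (Suc m)) \<bullet>c q i = complex_of_real (\<beta> m) * (if i' = m - 1 \<and> m \<noteq> 0 then 1 else 0)"
      by simp
    have 2: "q m \<bullet>c q i = (if i' = m - 1 \<and> m \<noteq> 0 then 1 else 0)" "q (Suc m) \<bullet>c q i = 0"
      using i False unfolding Suc by (auto simp: o)
    show ?thesis using tt unfolding 1 2 by simp
  qed
qed

text \<open>Absence of breakdown supplies exactly the nonzero \<open>\<beta> j\<close> with
  \<open>1 \<le> j < k\<close>, which turn \<open>next_orthogonal\<close> into orthogonality and
  make the normalisations of \<open>q 2\<close> up to \<open>q k\<close> effective.\<close>

lemma orthonormal: "m \<le> k \<Longrightarrow> orthonormal_upto m"
proof (induction m)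
  case 0
  show ?case by (simp add: orthonormal_upto_def q0_cscalar_prod del: lanczos_q.simps)
next
  case (Suc m)
  note [simp del] = lanczos_alpha.simps lanczos_beta.simps lanczos_q.simps
  have IH: "orthonormal_upto m" using Suc by simp
  have unit: "(complex_of_real (1 / norm2_vec x) \<cdot>\<^sub>v x) \<bullet>c (complex_of_real (1 / norm2_vec x) \<cdot>\<^sub>v x) = 1"
    if "norm2_vec x \<noteq> 0" for x
  proof -
    let ?c = "complex_of_real (1 / norm2_vec x)"
    have "(?c \<cdot>\<^sub>v x) \<bullet>c (?c \<cdot>\<^sub>v x) = ?c * (?c * (x \<bullet>c x))"
      by (subst cscalar_prod_smult_left, simp, subst cscalar_prod_smult_right) auto
    thus ?thesis using that unfolding cscalar_prod_self by (simp add: power2_eq_square)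
  qed
  have one: "q (Suc m) \<bullet>c q (Suc m) = 1"
  proof (cases m)
    case 0
    thus ?thesis using no_breakdown unit by (simp add: lanczos_no_breakdown_def lanczos_q.simps)
  next
    case (Suc m')
    have "\<beta> m \<noteq> 0" using no_breakdown Suc.prems Suc by (simp add: lanczos_no_breakdown_def)
    thus ?thesis using unit[of "r m"] by (simp add: Suc lanczos_q.simps lanczos_beta.simps del: lanczos_r.simps)
  qed
  have zero: "q (Suc m) \<bullet>c q i = 0" if "i \<le> m" for i
  proof (cases m)
    case 0
    thus ?thesis using that by (simp add: q0_cscalar_prod)
  next
    case (Suc m')
    have "\<beta> m \<noteq> 0" using no_breakdown Suc.prems Suc by (simp add: lanczos_no_breakdown_def)
    thus ?thesis using next_orthogonal[of m' i] IH that by (simp add: Suc)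
  qed
  have zero': "q i \<bullet>c q (Suc m) = 0" if "i \<le> m" for i
    using zero[OF that] cscalar_prod_swap[OF q_carrier q_carrier, of "Suc m" i] by simp
  show ?case unfolding orthonormal_upto_def
  proof (intro allI impI)
    fix i j assume "i \<le> Suc m" "j \<le> Suc m"
    thus "q i \<bullet>c q j = (if i = j \<and> i \<noteq> 0 then 1 else 0)"
      using IH one zero zero' by (auto simp: le_Suc_eq orthonormal_upto_def)
  qed
qed

lemma q_cscalar_prod: "i \<le> k \<Longrightarrow> j \<le> k \<Longrightarrow> q i \<bullet>c q j = (if i = j \<and> i \<noteq> 0 then 1 else 0)"
  using orthonormal[of k] by (auto simp: orthonormal_upto_def)

section \<open>The Lanczos basis and the projected matrix\<close>

lemma Q_carrier: "Q \<in> carrier_mat n k"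
  using mat_of_cols_carrier(1)[of n "map q [1..<Suc k]"] b_carrier by (simp add: lanczos_Q_def del: upt_Suc)

lemma T_carrier: "T \<in> carrier_mat k k"
  by (simp add: lanczos_T_def)

lemma col_Q: "j < k \<Longrightarrow> col Q j = q (Suc j)"
  using b_carrier by (simp add: lanczos_Q_def del: upt_Suc lanczos_q.simps)

lemma Q_index: "l < n \<Longrightarrow> j < k \<Longrightarrow> Q $$ (l, j) = q (Suc j) $ l"
  using col_Q[of j] Q_carrier by (metis carrier_matD index_col)

lemma Q_isometry: "mat_adjoint Q * Q = 1\<^sub>m k"
proof (rule eq_matI)
  fix i j assume "i < dim_row (1\<^sub>m k :: complex mat)" "j < dim_col (1\<^sub>m k :: complex mat)"
  hence ij: "i < k" "j < k" by auto
  show "(mat_adjoint Q * Q) $$ (i, j) = 1\<^sub>m k $$ (i, j)"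
    unfolding adjoint_mult_index[OF Q_carrier Q_carrier ij]
    using ij by (simp add: col_Q q_cscalar_prod del: lanczos_q.simps)
qed (use Q_carrier in auto)

lemma T_index:
  assumes "i < k" "j < k"
  shows "T $$ (i, j) = (if i = j then \<alpha> (Suc j) else if j = Suc i then complex_of_real (\<beta> j)
    else if i = Suc j then complex_of_real (\<beta> (Suc j)) else 0)"
  using assms by (auto simp: lanczos_T_def simp del: lanczos_alpha.simps lanczos_beta.simps)

lemma T_compression: "mat_adjoint Q * (A * Q) = T"
proof (rule eq_matI)
  note [simp del] = lanczos_alpha.simps lanczos_beta.simps lanczos_q.simps
  fix i j assume "i < dim_row T" "j < dim_col T"
  hence ij: "i < k" "j < k" using T_carrier by auto
  have "col (A * Q) j = A *\<^sub>v q (Suc j)"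
    using A_carrier Q_carrier ij col_Q[OF ij(2)] by (intro eq_vecI) auto
  hence "(mat_adjoint Q * (A * Q)) $$ (i, j) = (A *\<^sub>v q (Suc j)) \<bullet>c q (Suc i)"
    unfolding adjoint_mult_index[OF Q_carrier mult_carrier_mat[OF A_carrier Q_carrier] ij] by (simp add: col_Q ij)
  also have "\<dots> = complex_of_real (\<beta> j) * (q j \<bullet>c q (Suc i)) + \<alpha> (Suc j) * (q (Suc j) \<bullet>c q (Suc i))
    + complex_of_real (\<beta> (Suc j)) * (q (Suc (Suc j)) \<bullet>c q (Suc i))"
    by (rule three_term_cscalar_prod) simp
  \<comment> \<open>In the last column this term involves \<open>q (Suc k)\<close>, to which
    \<open>q_cscalar_prod\<close> does not apply. There \<open>i \<le> j\<close> always holds, and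
    \<open>next_orthogonal\<close> covers that case.\<close>
  also have "complex_of_real (\<beta> (Suc j)) * (q (Suc (Suc j)) \<bullet>c q (Suc i)) =
      (if i = Suc j then complex_of_real (\<beta> (Suc j)) else 0)"
  proof (cases "i \<le> j")
    case True
    thus ?thesis using next_orthogonal[OF orthonormal, of j "Suc i"] ij by simp
  next
    case False
    thus ?thesis using ij by (simp add: q_cscalar_prod)
  qed
  finally show "(mat_adjoint Q * (A * Q)) $$ (i, j) = T $$ (i, j)"
    using ij by (auto simp: T_index q_cscalar_prod)
qed (use Q_carrier T_carrier in auto)

text \<open>A compression of a Hermitian matrix is Hermitian; in particular the diagonal entries
  \<open>\<alpha>\<close> come out real without a separate argument.\<close>

lemma T_hermitian: "hermitian_mat T"
proof -
  have "mat_adjoint (mat_adjoint Q * (A * Q)) = mat_adjoint (A * Q) * Q"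
    using mat_adjoint_mult[OF mat_adjoint_carrier[OF Q_carrier] mult_carrier_mat[OF A_carrier Q_carrier]]
    by simp
  also have "mat_adjoint (A * Q) = mat_adjoint Q * A"
    using mat_adjoint_mult[OF A_carrier Q_carrier] A_hermitian by (simp add: hermitian_mat_def)
  also have "\<dots> * Q = mat_adjoint Q * (A * Q)"
    using mat_adjoint_carrier[OF Q_carrier] A_carrier Q_carrier by (rule assoc_mult_mat)
  finally show ?thesis unfolding T_compression hermitian_mat_def .
qed

text \<open>The remainder term of the Lanczos relation only affects the last column, so all other
  columns agree exactly.\<close>

lemma AQ_index:
  assumes l: "l < n" and j: "Suc j < k"
  shows "(A * Q) $$ (l, j) = (Q * T) $$ (l, j)"
proof -
  note [simp del] = lanczos_alpha.simps lanczos_beta.simps lanczos_q.simps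
  let ?a = "\<alpha> (Suc j) * q (Suc j) $ l" and ?b = "complex_of_real (\<beta> j) * q j $ l"
    and ?c = "complex_of_real (\<beta> (Suc j)) * q (Suc (Suc j)) $ l"
  have "(Q * T) $$ (l, j) = (\<Sum>i<k. q (Suc i) $ l * T $$ (i, j))"
    using Q_carrier T_carrier l j by (auto simp: scalar_prod_def lessThan_atLeast0 Q_index intro!: sum.cong)
  also have "\<dots> = (\<Sum>i<k. (if i = j then ?a else 0) + (if j = Suc i then ?b else 0) + (if i = Suc j then ?c else 0))"
    using j by (intro sum.cong) (auto simp: T_index)
  also have "\<dots> = ?a + (\<Sum>i<k. if j = Suc i then ?b else 0) + ?c"
    using j by (simp add: sum.distrib)
  \<comment> \<open>For \<open>j = 0\<close> no index contributes, and the right side vanishes as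
    well because \<open>\<beta> 0\<close> is 0.\<close>
  also have "(\<Sum>i<k. if j = Suc i then ?b else 0) = ?b"
  proof (cases j)
    case 0
    thus ?thesis by (simp add: lanczos_beta.simps)
  next
    case (Suc j')
    hence "(\<Sum>i<k. if j = Suc i then ?b else 0) = (\<Sum>i<k. if i = j' then ?b else 0)"
      by (intro sum.cong) auto
    thus ?thesis using Suc j by simp
  qed
  also have "?a + ?b + ?c = (A *\<^sub>v q (Suc j)) $ l"
    unfolding three_term_index[OF l] by simp
  also have "\<dots> = (A * Q) $$ (l, j)"
    using A_carrier Q_carrier l j col_Q[of j] by simp
  finally show ?thesis by simp
qed

text \<open>A vector with zero last coordinate does not see the column in which \<open>A * Q\<close>
  and \<open>Q * T\<close> may differ. The premise \<open>k \<le> Suc j\<close> singles out that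
  coordinate without natural-number subtraction.\<close>

lemma AQ_mult_vec:
  fixes x :: "complex vec"
  assumes x: "x \<in> carrier_vec k" and x0: "\<And>j. j < k \<Longrightarrow> k \<le> Suc j \<Longrightarrow> x $ j = 0"
  shows "A *\<^sub>v (Q *\<^sub>v x) = Q *\<^sub>v (T *\<^sub>v x)"
proof -
  note AQ = mult_carrier_mat[OF A_carrier Q_carrier] and QT = mult_carrier_mat[OF Q_carrier T_carrier]
  have "(A * Q) *\<^sub>v x = (Q * T) *\<^sub>v x"
  proof (rule eq_vecI)
    fix l assume "l < dim_vec ((Q * T) *\<^sub>v x)"
    hence l: "l < n" using Q_carrier by simp
    have "(A * Q) $$ (l, j) * x $ j = (Q * T) $$ (l, j) * x $ j" if "j < k" for j
      using AQ_index[OF l, of j] x0[OF that] by (cases "Suc j < k") auto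
    thus "((A * Q) *\<^sub>v x) $ l = ((Q * T) *\<^sub>v x) $ l"
      unfolding mult_mat_vec_sum[OF AQ x l] mult_mat_vec_sum[OF QT x l] by (intro sum.cong) auto
  qed (use A_carrier Q_carrier in auto)
  thus ?thesis
    by (simp add: assoc_mult_mat_vec[OF A_carrier Q_carrier x] assoc_mult_mat_vec[OF Q_carrier T_carrier x])
qed

section \<open>Krylov vectors and exactness on low powers\<close>

lemma Qb_index:
  assumes "i < k"
  shows "(mat_adjoint Q *\<^sub>v b) $ i = (if i = 0 then complex_of_real (norm2_vec b) else 0)"
proof -
  have nb: "norm2_vec b \<noteq> 0" using no_breakdown by (simp add: lanczos_no_breakdown_def)
  have b: "b = complex_of_real (norm2_vec b) \<cdot>\<^sub>v q (Suc 0)"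
    using nb by (simp add: smult_smult_assoc)
  have "(mat_adjoint Q *\<^sub>v b) $ i = b \<bullet>c col Q i"
    using assms Q_carrier b_carrier
    by (auto simp: scalar_prod_def mat_adjoint_index mult.commute intro!: sum.cong)
  also have "\<dots> = complex_of_real (norm2_vec b) * (q (Suc 0) \<bullet>c q (Suc i))"
    unfolding col_Q[OF assms] by (subst b) (simp add: cscalar_prod_smult_left del: lanczos_q.simps)
  finally show ?thesis using assms by (simp add: q_cscalar_prod del: lanczos_q.simps)
qed

lemma QQb:
  assumes k: "1 \<le> k"
  shows "Q *\<^sub>v (mat_adjoint Q *\<^sub>v b) = b"
proof (rule eq_vecI)
  have nb: "norm2_vec b \<noteq> 0" using no_breakdown by (simp add: lanczos_no_breakdown_def)
  have Qb: "mat_adjoint Q *\<^sub>v b \<in> carrier_vec k"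
    using mat_adjoint_carrier[OF Q_carrier] b_carrier by (rule mult_mat_vec_carrier)
  fix l assume "l < dim_vec b"
  hence l: "l < n" using b_carrier by simp
  have "(Q *\<^sub>v (mat_adjoint Q *\<^sub>v b)) $ l = (\<Sum>j<k. if j = 0 then q (Suc 0) $ l * complex_of_real (norm2_vec b) else 0)"
    unfolding mult_mat_vec_sum[OF Q_carrier Qb l]
    by (intro sum.cong) (auto simp: Q_index l Qb_index simp del: lanczos_q.simps index_mult_mat_vec)
  also have "\<dots> = q (Suc 0) $ l * complex_of_real (norm2_vec b)" using k by (simp del: lanczos_q.simps)
  also have "\<dots> = b $ l" using l nb b_carrier by simp
  finally show "(Q *\<^sub>v (mat_adjoint Q *\<^sub>v b)) $ l = b $ l" .
qed (use Q_carrier b_carrier in auto)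

text \<open>As \<open>T\<close> is tridiagonal and \<open>mat_adjoint Q *\<^sub>v b\<close> is
  supported on coordinate 0, each multiplication by \<open>T\<close> enlarges the support by at most
  one coordinate. Before the last coordinate is reached, \<open>A\<close> acts on the range of
  \<open>Q\<close> just as \<open>T\<close> does.\<close>

lemma krylov:
  assumes "m < k"
  defines "x \<equiv> ((\<lambda>v. T *\<^sub>v v) ^^ m) (mat_adjoint Q *\<^sub>v b)"
  shows "x \<in> carrier_vec k \<and> (\<forall>i<k. m < i \<longrightarrow> x $ i = 0) \<and> ((\<lambda>v. A *\<^sub>v v) ^^ m) b = Q *\<^sub>v x"
  using assms(1) unfolding x_def
proof (induction m)
  case 0
  thus ?case using Qb_index QQb mult_mat_vec_carrier[OF mat_adjoint_carrier[OF Q_carrier] b_carrier] by simp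
next
  case (Suc m)
  define x where "x = ((\<lambda>v. T *\<^sub>v v) ^^ m) (mat_adjoint Q *\<^sub>v b)"
  have x: "x \<in> carrier_vec k" and x0: "\<And>i. i < k \<Longrightarrow> m < i \<Longrightarrow> x $ i = 0"
    and Ab: "((\<lambda>v. A *\<^sub>v v) ^^ m) b = Q *\<^sub>v x"
    using Suc by (auto simp: x_def)
  have "(T *\<^sub>v x) $ i = 0" if i: "i < k" "Suc m < i" for i
  proof -
    have "T $$ (i, j) * x $ j = 0" if "j < k" for j
      using x0[of j] i that T_index[of i j] by (cases "m < j") auto
    thus ?thesis unfolding mult_mat_vec_sum[OF T_carrier x i(1)] by (intro sum.neutral) auto
  qed
  moreover have "A *\<^sub>v (Q *\<^sub>v x) = Q *\<^sub>v (T *\<^sub>v x)"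
    \<comment> \<open>With \<open>Suc m < k\<close> the last index \<open>k - 1\<close> exceeds
      \<open>m\<close>, so \<open>x\<close> is zero there.\<close>
    by (rule AQ_mult_vec[OF x]) (use x0 Suc.prems in auto)
  ultimately show ?case
    using mult_mat_vec_carrier[OF T_carrier x] Ab by (simp add: x_def[symmetric])
qed

text \<open>Both sides are the Krylov vector described by \<open>krylov\<close>. This exactness is
  the source of the moment conditions.\<close>

lemma lan_power:
  assumes "m < k"
  shows "mat_fun (\<lambda>z. z ^ m) A *\<^sub>v b = lan A b k (\<lambda>z. z ^ m)"
proof -
  obtain U d where E: "eigendecomposition A U (\<lambda>i. complex_of_real (d i))"
    using hermitian_eigendecomposition[OF A_carrier A_hermitian] .
  obtain V \<theta> where F: "eigendecomposition T V (\<lambda>i. complex_of_real (\<theta> i))"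
    using hermitian_eigendecomposition[OF T_carrier T_hermitian] .
  have Qb: "mat_adjoint Q *\<^sub>v b \<in> carrier_vec k"
    using mat_adjoint_carrier[OF Q_carrier] b_carrier by (rule mult_mat_vec_carrier)
  show ?thesis
    unfolding lan_def mat_fun_power_mult_vec[OF E A_carrier b_carrier] mat_fun_power_mult_vec[OF F T_carrier Qb]
    using krylov[OF assms] by simp
qed

end

subsection \<open>Contour integrals over the circle\<close>

lemma arclength_integral_circlepath:
  assumes "r \<ge> 0"
  shows "arclength_integral (circlepath c r) g = integral {0..1} (\<lambda>t. g (circlepath c r t) * (2 * pi * r))"
  unfolding arclength_integral_def
  by (rule integral_cong) (use assms in \<open>auto simp: vector_derivative_circlepath01 norm_mult\<close>)

lemma circlepath_in_sphere: "r \<ge> 0 \<Longrightarrow> circlepath c r t \<in> sphere c r"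
  by (simp add: circlepath dist_norm norm_mult)

lemma continuous_on_circlepath_compose:
  assumes "continuous_on (sphere c r) f" "r \<ge> 0"
  shows "continuous_on {0..1} (\<lambda>t. f (circlepath c r t))"
  using path_circlepath[of c r] circlepath_in_sphere[OF assms(2)]
  by (intro continuous_on_compose2[OF assms(1)]) (auto simp: path_def)

text \<open>The derivative of \<open>circlepath\<close> has constant modulus
  \<open>2 * pi * r\<close>, so domination on the circle passes to the integrands over the parameter
  interval.\<close>

lemma contour_integral_circlepath_bound:
  fixes f h :: "complex \<Rightarrow> complex"
  assumes r: "r \<ge> 0" and h: "continuous_on (sphere c r) h" and f: "continuous_on (sphere c r) f"
    and le: "\<And>z. z \<in> sphere c r \<Longrightarrow> cmod (h z) \<le> cmod (f z)"
  shows "cmod (contour_integral (circlepath c r) h) \<le> arclength_integral (circlepath c r) (\<lambda>z. cmod (f z))"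
  unfolding contour_integral_integral arclength_integral_circlepath[OF r]
proof (rule Henstock_Kurzweil_Integration.integral_norm_bound_integral)
  show "(\<lambda>t. h (circlepath c r t) * vector_derivative (circlepath c r) (at t)) integrable_on {0..1}"
    unfolding vector_derivative_circlepath
    by (intro integrable_continuous_real continuous_intros continuous_on_circlepath_compose[OF h r])
  show "(\<lambda>t. cmod (f (circlepath c r t)) * (2 * pi * r)) integrable_on {0..1}"
    by (intro integrable_continuous_real continuous_intros continuous_on_circlepath_compose[OF f r])
  show "cmod (h (circlepath c r t) * vector_derivative (circlepath c r) (at t))
      \<le> cmod (f (circlepath c r t)) * (2 * pi * r)" for t
    using le[OF circlepath_in_sphere[OF r]] r
    by (auto simp: vector_derivative_circlepath norm_mult intro!: mult_right_mono)
qed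

lemma arclength_integral_circlepath_le:
  fixes f :: "complex \<Rightarrow> complex"
  assumes r: "r \<ge> 0" and f: "continuous_on (sphere c r) f"
  shows "1 / (2 * pi) * arclength_integral (circlepath c r) (\<lambda>z. cmod (f z)) \<le> r * (SUP z\<in>sphere c r. cmod (f z))"
proof -
  let ?S = "SUP z\<in>sphere c r. cmod (f z)"
  \<comment> \<open>Boundedness has to be secured first: only then is the real \<open>SUP\<close> an
    upper bound.\<close>
  have "compact ((\<lambda>z. cmod (f z)) ` sphere c r)"
    by (intro compact_continuous_image continuous_intros f) simp
  hence "bdd_above ((\<lambda>z. cmod (f z)) ` sphere c r)"
    by (intro bounded_imp_bdd_above compact_imp_bounded)
  hence le: "cmod (f z) \<le> ?S" if "z \<in> sphere c r" for z
    using that by (intro cSUP_upper)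
  have "integral {0..1} (\<lambda>t. cmod (f (circlepath c r t)) * (2 * pi * r)) \<le> integral {0..1} (\<lambda>t::real. ?S * (2 * pi * r))"
    by (intro integral_le integrable_continuous_real continuous_intros continuous_on_circlepath_compose[OF f r]
        mult_right_mono le circlepath_in_sphere r) (use r in auto)
  also have "\<dots> = ?S * (2 * pi * r)" by simp
  finally show ?thesis unfolding arclength_integral_circlepath[OF r]
    by (simp add: field_simps)
qed

text \<open>The scalar G of the overview, with \<open>\<theta>\<close> the nodes and
  \<open>x\<close> the eigenvalue. The factor next to \<open>f z\<close> is the ratio of the error
  coordinates at the shifts \<open>z\<close> and \<open>w\<close>, free of the weights. The minus
  sign turns \<open>1 / (x - z)\<close> into the Cauchy kernel \<open>1 / (z - x)\<close>.\<close>

definition resolvent_transfer ::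
    "(complex \<Rightarrow> complex) \<Rightarrow> real \<Rightarrow> real \<Rightarrow> nat \<Rightarrow> (nat \<Rightarrow> real) \<Rightarrow> complex \<Rightarrow> complex" where
  "resolvent_transfer f c w k \<theta> x = - 1 / (2 * pi * \<i>) *
     contour_integral (circlepath c (c - w))
       (\<lambda>z. f z * ((\<Prod>j<k. (w - \<theta> j) / (z - \<theta> j)) * ((x - w) / (x - z))))"

text \<open>The circle around \<open>c\<close> passes through \<open>w\<close>, and by the triangle
  inequality no point of it is closer to \<open>x\<close> than \<open>w\<close> is.\<close>

lemma sphere_dist_lower:
  fixes c w x :: real and z :: complex
  assumes "w < x" "x \<le> c" "z \<in> sphere (complex_of_real c) (c - w)"
  shows "x - w \<le> cmod (z - x)" "z \<noteq> x"
proof -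
  have "c - w = cmod (z - c)" using assms by (simp add: dist_norm norm_minus_commute)
  also have "\<dots> \<le> cmod (z - x) + cmod (complex_of_real x - c)"
    using norm_triangle_ineq[of "z - x" "complex_of_real x - c"] by simp
  also have "cmod (complex_of_real x - c) = c - x"
    using assms by (metis abs_of_nonneg diff_ge_0_iff_ge norm_minus_commute norm_of_real of_real_diff)
  finally show 1: "x - w \<le> cmod (z - x)" by simp
  show "z \<noteq> x" using 1 assms by auto
qed

lemma resolvent_transfer_integrand_continuous:
  fixes c w x :: real
  assumes f: "continuous_on (sphere (complex_of_real c) (c - w)) f"
    and x: "w < x" "x \<le> c" and \<theta>: "\<And>j. j < k \<Longrightarrow> w < \<theta> j \<and> \<theta> j \<le> c"
  shows "continuous_on (sphere (complex_of_real c) (c - w))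
    (\<lambda>z. f z * ((\<Prod>j<k. (w - \<theta> j) / (z - \<theta> j)) * ((x - w) / (x - z))))"
proof -
  have "complex_of_real x - z \<noteq> 0" if "z \<in> sphere (complex_of_real c) (c - w)" for z :: complex
    using sphere_dist_lower(2)[OF x that] by auto
  moreover have "z - complex_of_real (\<theta> j) \<noteq> 0" if "z \<in> sphere (complex_of_real c) (c - w)" "j < k" for z :: complex and j
    using sphere_dist_lower(2)[OF _ _ that(1), of "\<theta> j"] \<theta>[OF that(2)] by auto
  ultimately show ?thesis by (intro continuous_intros f ballI) auto
qed

text \<open>Among the points of the circle, \<open>w\<close> is nearest to each node and to
  \<open>x\<close>, so every factor of the ratio has modulus at most 1.\<close>

lemma resolvent_transfer_bound:
  fixes c w x :: real
  assumes f: "continuous_on (sphere (complex_of_real c) (c - w)) f"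
    and x: "w < x" "x \<le> c" and \<theta>: "\<And>j. j < k \<Longrightarrow> w < \<theta> j \<and> \<theta> j \<le> c"
  shows "cmod (resolvent_transfer f c w k \<theta> x)
    \<le> 1 / (2 * pi) * arclength_integral (circlepath c (c - w)) (\<lambda>z. cmod (f z))"
proof -
  let ?h = "\<lambda>z::complex. f z * ((\<Prod>j<k. (w - \<theta> j) / (z - \<theta> j)) * ((x - w) / (x - z)))"
  have ratio: "cmod (complex_of_real (w - t) / (z - t)) \<le> 1"
    if "z \<in> sphere (complex_of_real c) (c - w)" "w < t" "t \<le> c" for t :: real and z :: complex
    using sphere_dist_lower[OF that(2,3,1)] that by (simp add: norm_divide del: of_real_diff)
  have "cmod (?h z) \<le> cmod (f z)" if z: "z \<in> sphere (complex_of_real c) (c - w)" for z :: complex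
  proof -
    have "cmod (\<Prod>j<k. complex_of_real (w - \<theta> j) / (z - \<theta> j)) \<le> 1"
      using \<theta> ratio[OF z] unfolding prod_norm[symmetric] by (intro prod_le_1) auto
    moreover have "cmod ((x - w) / (x - z)) \<le> 1"
      using ratio[OF z x] by (simp add: norm_divide norm_minus_commute)
    ultimately have "cmod (\<Prod>j<k. complex_of_real (w - \<theta> j) / (z - \<theta> j)) * cmod ((x - w) / (x - z)) \<le> 1"
      by (intro mult_le_one) auto
    thus ?thesis unfolding norm_mult
      using mult_left_mono[of _ 1 "cmod (f z)"] by simp
  qed
  hence "cmod (contour_integral (circlepath c (c - w)) ?h)
      \<le> arclength_integral (circlepath c (c - w)) (\<lambda>z. cmod (f z))"
    using x by (intro contour_integral_circlepath_bound resolvent_transfer_integrand_continuous f x \<theta>) auto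
  thus ?thesis unfolding resolvent_transfer_def
    by (simp add: norm_mult norm_divide field_simps)
qed

text \<open>Cauchy's formula at \<open>d\<close> and at all nodes writes the left side as one
  integral of \<open>f z\<close> against the resolvent error at \<open>z\<close>.
  \<open>moment_matching_resolvent\<close>, used at \<open>z\<close> and at \<open>w\<close>,
  replaces that error by a multiple of the one at \<open>w\<close>, which leaves the integral as a
  constant.\<close>

lemma resolvent_transfer:
  fixes c w d :: real and y :: complex and a :: "nat \<Rightarrow> complex"
  assumes f: "f holomorphic_on S" "cball (complex_of_real c) (c - w) \<subseteq> S"
    and d: "w < d" "d \<le> c" and \<theta>: "\<And>j. j < k \<Longrightarrow> w < \<theta> j \<and> \<theta> j \<le> c"
    and k: "1 \<le> k"
    and mom: "\<And>m. m < k \<Longrightarrow> y * complex_of_real d ^ m = (\<Sum>j<k. a j * complex_of_real (\<theta> j) ^ m)"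
  shows "y * f d - (\<Sum>j<k. a j * f (\<theta> j)) =
    resolvent_transfer f c w k \<theta> d * (y * (1 / (complex_of_real d - w)) - (\<Sum>j<k. a j * (1 / (complex_of_real (\<theta> j) - w))))"
proof -
  let ?C = "circlepath c (c - w)" and ?P = "\<lambda>z::complex. (\<Prod>j<k. z - complex_of_real (\<theta> j))"
  let ?h = "\<lambda>z::complex. f z * ((\<Prod>j<k. (w - \<theta> j) / (z - \<theta> j)) * ((d - w) / (d - z)))"
  have fcont: "continuous_on (cball (complex_of_real c) (c - w)) f"
    using f holomorphic_on_imp_continuous_on holomorphic_on_subset by blast
  have scont: "continuous_on (sphere (complex_of_real c) (c - w)) f"
    by (rule continuous_on_subset[OF fcont]) auto
  have fhol: "f holomorphic_on ball (complex_of_real c) (c - w)"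
    using f ball_subset_cball holomorphic_on_subset by blast
  have cauchy: "((\<lambda>z. f z / (z - t)) has_contour_integral (2 * pi * \<i> * f t)) ?C" if "w < t" "t \<le> c" for t :: real
  proof -
    have "cmod (complex_of_real t - c) < c - w"
      using that by (simp flip: of_real_diff)
    from Cauchy_integral_circlepath[OF fcont fhol this] show ?thesis by simp
  qed
  \<comment> \<open>The value of the error functional on the function sending \<open>x\<close> to
    \<open>1 / (x - z)\<close>.\<close>
  define e where "e z = y / (d - z) - (\<Sum>j<k. a j / (\<theta> j - z))" for z :: complex
  have e: "e z = y * ?P d / (?P z * (d - z))" if "z \<noteq> d" "\<And>j. j < k \<Longrightarrow> z \<noteq> \<theta> j" for z :: complex
    unfolding e_def using moment_matching_resolvent[OF mom k that] .
  have ew: "e w = y * ?P d / (?P w * (complex_of_real d - w))" using d \<theta> by (intro e) auto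
  have w0: "?P w \<noteq> 0" "complex_of_real d - w \<noteq> 0" using d \<theta> by auto
  have "((\<lambda>z. y * (f z / (z - d)) - (\<Sum>j<k. a j * (f z / (z - \<theta> j)))) has_contour_integral
      (y * (2 * pi * \<i> * f d) - (\<Sum>j<k. a j * (2 * pi * \<i> * f (\<theta> j))))) ?C"
    using d \<theta>
    by (intro has_contour_integral_diff has_contour_integral_lmul has_contour_integral_sum cauchy) auto
  moreover have "y * (f z / (z - d)) - (\<Sum>j<k. a j * (f z / (z - \<theta> j))) = - e w * ?h z"
    if z: "z \<in> path_image ?C" for z :: complex
  proof -
    have z': "z \<in> sphere (complex_of_real c) (c - w)" using z d by simp
    note zd = sphere_dist_lower(2)[OF d z']
    have z\<theta>: "z \<noteq> \<theta> j" if "j < k" for j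
      using sphere_dist_lower(2)[OF _ _ z', of "\<theta> j"] \<theta>[OF that] by auto
    have flip: "u / (z - t) = - (u / (t - z))" for u t :: complex
      by (metis minus_diff_eq minus_divide_right)
    have "y * (f z / (z - d)) - (\<Sum>j<k. a j * (f z / (z - \<theta> j))) = - (f z * e z)"
      unfolding e_def flip right_diff_distrib sum_distrib_left
      by (simp add: sum_negf mult_ac)
    \<comment> \<open>The common factor \<open>y * ?P d\<close> may be zero, so \<open>e z\<close>
      is not divided by \<open>e w\<close>; only the nonzero \<open>?P w\<close> and
      \<open>d - w\<close> are cancelled.\<close>
    also have "e z = e w * ((?P w / ?P z) * ((d - w) / (d - z)))"
      unfolding e[OF zd z\<theta>, simplified] ew using w0 by simp
    also have "?P w / ?P z = (\<Prod>j<k. (w - \<theta> j) / (z - \<theta> j))" by (simp add: prod_dividef)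
    finally show ?thesis by (simp add: mult_ac)
  qed
  ultimately have 1: "((\<lambda>z. - e w * ?h z) has_contour_integral
      (y * (2 * pi * \<i> * f d) - (\<Sum>j<k. a j * (2 * pi * \<i> * f (\<theta> j))))) ?C"
    by (rule has_contour_integral_eq)
  have "?h contour_integrable_on ?C"
  proof (rule contour_integrable_continuous_circlepath)
    have "path_image ?C = sphere (complex_of_real c) (c - w)" using d by simp
    thus "continuous_on (path_image ?C) ?h"
      using resolvent_transfer_integrand_continuous[OF scont d \<theta>] by simp
  qed
  from has_contour_integral_unique[OF has_contour_integral_lmul[OF has_contour_integral_integral[OF this], of "- e w"] 1]
  have "2 * pi * \<i> * (y * f d - (\<Sum>j<k. a j * f (\<theta> j))) = - e w * contour_integral ?C ?h"
    by (simp add: right_diff_distrib sum_distrib_left mult_ac)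
  hence "y * f d - (\<Sum>j<k. a j * f (\<theta> j)) = (- e w * contour_integral ?C ?h) / (2 * pi * \<i>)"
    by (metis (no_types, lifting) i_squared complex_i_not_zero mult_eq_0_iff nonzero_mult_div_cancel_left of_real_eq_0_iff pi_neq_zero zero_neq_numeral)
  also have "\<dots> = resolvent_transfer f c w k \<theta> d * e w"
    unfolding resolvent_transfer_def by simp
  finally show ?thesis unfolding e_def by simp
qed

subsection \<open>Norms induced by matrices commuting with \<open>A\<close>\<close>

text \<open>\<open>M\<close> maps each eigenspace of \<open>A\<close> into itself, and eigenspaces
  of a Hermitian matrix for distinct eigenvalues are orthogonal. The computation evaluates the inner
  product of \<open>A *\<^sub>v (M *\<^sub>v col U j)\<close> with \<open>col U i\<close> in two
  ways.\<close>

lemma commuting_eigenbasis_entry: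
  assumes A: "A \<in> carrier_mat n n" "hermitian_mat A" and M: "M \<in> carrier_mat n n" "M * A = A * M"
    and E: "eigendecomposition A U (\<lambda>i. complex_of_real (d i))"
    and ij: "i < n" "j < n" "d i \<noteq> d j"
  shows "(mat_adjoint U * (M * U)) $$ (i, j) = 0"
proof -
  note U = eigendecompositionD(1)[OF E A(1)]
  note ui = eigendecomposition_col[OF E A(1) ij(1)] and uj = eigendecomposition_col[OF E A(1) ij(2)]
  let ?N = "(M *\<^sub>v col U j) \<bullet>c col U i"
  have Mu: "M *\<^sub>v col U j \<in> carrier_vec n" using M(1) uj(3) by (rule mult_mat_vec_carrier)
  have "M *\<^sub>v (A *\<^sub>v col U j) = A *\<^sub>v (M *\<^sub>v col U j)"
    using assoc_mult_mat_vec[OF M(1) A(1) uj(3)] assoc_mult_mat_vec[OF A(1) M(1) uj(3)] M(2) by simp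
  hence "complex_of_real (d j) \<cdot>\<^sub>v (M *\<^sub>v col U j) = A *\<^sub>v (M *\<^sub>v col U j)"
    unfolding uj(1) mult_mat_vec[OF M(1) uj(3)] .
  hence "complex_of_real (d j) * ?N = (A *\<^sub>v (M *\<^sub>v col U j)) \<bullet>c col U i"
    using Mu ui(3) cscalar_prod_smult_left[of "M *\<^sub>v col U j" "col U i" "complex_of_real (d j)"]
    by (metis carrier_vecD)
  also have "\<dots> = (M *\<^sub>v col U j) \<bullet>c (complex_of_real (d i) \<cdot>\<^sub>v col U i)"
    unfolding hermitian_cscalar_prod[OF A Mu ui(3)] ui(1) ..
  also have "\<dots> = complex_of_real (d i) * ?N"
    using cscalar_prod_smult_right[of "M *\<^sub>v col U j" "col U i" "complex_of_real (d i)"] Mu ui(3)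
    by (metis carrier_vecD complex_cnj_complex_of_real)
  finally have "?N = 0" using ij(3) by simp
  moreover have "col (M * U) j = M *\<^sub>v col U j" using M(1) U ij by (intro eq_vecI) auto
  ultimately show ?thesis
    unfolding adjoint_mult_index[OF U mult_carrier_mat[OF M(1) U] ij(1,2)] by simp
qed

text \<open>With repeated eigenvalues \<open>U\<close> may fail to diagonalise \<open>M\<close>,
  which is only block diagonal in this basis. The quadratic form is therefore split by eigenvalue
  and not by index; on each block the multiplier is one scalar.\<close>

lemma norm_induced_spectral_multiplier:
  fixes G :: "complex \<Rightarrow> complex" and x y :: "complex vec"
  assumes A: "A \<in> carrier_mat n n" "hermitian_mat A" and M: "pos_def_mat n M" "M * A = A * M"
    and E: "eigendecomposition A U (\<lambda>i. complex_of_real (d i))"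
    and x: "x \<in> carrier_vec n" and y: "y \<in> carrier_vec n" and K: "0 \<le> K"
    and G: "\<And>i. i < n \<Longrightarrow> cmod (G (d i)) \<le> K"
    and xy: "\<And>i. i < n \<Longrightarrow> (mat_adjoint U *\<^sub>v y) $ i = G (d i) * (mat_adjoint U *\<^sub>v x) $ i"
  shows "norm_induced M y \<le> K * norm_induced M x"
proof -
  note D = eigendecompositionD[OF E A(1)]
  have un: "unitary_mat n U" using E A by (auto simp: eigendecomposition_def)
  have Mc: "M \<in> carrier_mat n n" using M(1) by (simp add: pos_def_mat_def)
  define N where "N = mat_adjoint U * (M * U)"
  have Nc: "N \<in> carrier_mat n n" unfolding N_def using D(1,2) Mc by auto
  define L where "L = d ` {..<n}"
  \<comment> \<open>\<open>part l u\<close> keeps the coordinates of \<open>u\<close> that belong to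
    the eigenvalue \<open>l\<close>.\<close>
  define part where "part l u = vec n (\<lambda>i. if d i = l then u $ i else 0)" for l and u :: "complex vec"
  have pc [simp]: "part l u \<in> carrier_vec n" for l u by (simp add: part_def)
  define B where "B u = (\<Sum>i<n. \<Sum>j<n. N $$ (i, j) * (u $ j * cnj (u $ i)))" for u :: "complex vec"
  have B: "(M *\<^sub>v (U *\<^sub>v u)) \<bullet>c (U *\<^sub>v u) = B u" if u: "u \<in> carrier_vec n" for u
  proof -
    have Uu: "U *\<^sub>v u \<in> carrier_vec n" using D(1) u by (rule mult_mat_vec_carrier)
    have MUu: "M *\<^sub>v (U *\<^sub>v u) \<in> carrier_vec n" using Mc Uu by (rule mult_mat_vec_carrier)
    have "(M *\<^sub>v (U *\<^sub>v u)) \<bullet>c (U *\<^sub>v u) = (mat_adjoint U *\<^sub>v (M *\<^sub>v (U *\<^sub>v u))) \<bullet>c u"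
      using cscalar_prod_adjoint[OF D(2) MUu u] by simp
    also have "mat_adjoint U *\<^sub>v (M *\<^sub>v (U *\<^sub>v u)) = N *\<^sub>v u"
      unfolding N_def assoc_mult_mat_vec[OF D(2) mult_carrier_mat[OF Mc D(1)] u] assoc_mult_mat_vec[OF Mc D(1) u] ..
    also have "(N *\<^sub>v u) \<bullet>c u = B u"
      unfolding cscalar_prod_sum[OF u] B_def
      by (intro sum.cong) (auto simp: mult_mat_vec_sum[OF Nc u] sum_distrib_right mult.assoc simp del: index_mult_mat_vec)
    finally show ?thesis .
  qed
  \<comment> \<open>Positive definiteness is stated for nonzero vectors, hence the separate
    treatment of zero.\<close>
  have pos: "0 \<le> Re (B u)" if u: "u \<in> carrier_vec n" for u
  proof -
    have Uu: "U *\<^sub>v u \<in> carrier_vec n" using D(1) u by (rule mult_mat_vec_carrier)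
    show ?thesis
    proof (cases "U *\<^sub>v u = 0\<^sub>v n")
      case True
      thus ?thesis unfolding B[OF u, symmetric] using Mc by (simp add: scalar_prod_right_zero[of _ n])
    next
      case False
      thus ?thesis unfolding B[OF u, symmetric] using M(1) Uu by (auto simp: pos_def_mat_def intro: less_imp_le)
    qed
  qed
  have split: "B u = (\<Sum>l\<in>L. B (part l u))" if u: "u \<in> carrier_vec n" for u
  proof -
    \<comment> \<open>Summing over the blocks retains exactly the index pairs with equal
      eigenvalues; the other entries of \<open>N\<close> are zero.\<close>
    have "(\<Sum>l\<in>L. B (part l u)) = (\<Sum>l\<in>L. \<Sum>i<n. \<Sum>j<n. if d i = l \<and> d j = l then N $$ (i, j) * (u $ j * cnj (u $ i)) else 0)"
      unfolding B_def part_def by (intro sum.cong refl) auto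
    also have "\<dots> = (\<Sum>i<n. \<Sum>l\<in>L. \<Sum>j<n. if d i = l \<and> d j = l then N $$ (i, j) * (u $ j * cnj (u $ i)) else 0)"
      by (rule sum.swap)
    also have "\<dots> = (\<Sum>i<n. \<Sum>j<n. \<Sum>l\<in>L. if d i = l \<and> d j = l then N $$ (i, j) * (u $ j * cnj (u $ i)) else 0)"
      by (intro sum.cong refl sum.swap)
    also have "\<dots> = B u" unfolding B_def
    proof (intro sum.cong refl)
      fix i j assume "i \<in> {..<n}" "j \<in> {..<n}"
      hence ij: "i < n" "j < n" by auto
      show "(\<Sum>l\<in>L. if d i = l \<and> d j = l then N $$ (i, j) * (u $ j * cnj (u $ i)) else 0)
          = N $$ (i, j) * (u $ j * cnj (u $ i))"
      proof (cases "d i = d j")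
        case True
        have "finite L" "d j \<in> L" using ij by (auto simp: L_def)
        thus ?thesis using True by simp
      next
        case False
        have "N $$ (i, j) = 0" unfolding N_def
          by (rule commuting_eigenbasis_entry[OF A Mc M(2) E ij False])
        thus ?thesis by simp
      qed
    qed
    finally show ?thesis by simp
  qed
  define x' where "x' = mat_adjoint U *\<^sub>v x"
  define y' where "y' = mat_adjoint U *\<^sub>v y"
  have x'c: "x' \<in> carrier_vec n" and y'c: "y' \<in> carrier_vec n"
    unfolding x'_def y'_def using D(2) x y by (auto intro: mult_mat_vec_carrier)
  have Bx: "(M *\<^sub>v x) \<bullet>c x = B x'" and By: "(M *\<^sub>v y) \<bullet>c y = B y'"
    using B[OF x'c] B[OF y'c] unitary_mult_vec(2)[OF un x] unitary_mult_vec(2)[OF un y]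
    by (simp_all add: x'_def y'_def)
  have "Re (B (part l y')) \<le> K\<^sup>2 * Re (B (part l x'))" if l: "l \<in> L" for l
  proof -
    have pl: "part l y' $ i = G l * part l x' $ i" if "i < n" for i
      using that xy[OF that] by (simp add: part_def x'_def y'_def del: index_mult_mat_vec)
    \<comment> \<open>\<open>G l\<close> is constant on the block and enters the form once plainly
      and once conjugated.\<close>
    have "B (part l y') = complex_of_real ((cmod (G l))\<^sup>2) * B (part l x')"
      unfolding B_def complex_norm_square sum_distrib_left
      by (intro sum.cong refl) (auto simp: pl)
    hence "Re (B (part l y')) = (cmod (G l))\<^sup>2 * Re (B (part l x'))"
      by (simp del: of_real_power)
    also have "\<dots> \<le> K\<^sup>2 * Re (B (part l x'))"
      using l G by (intro mult_right_mono pos power_mono) (auto simp: L_def)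
    finally show ?thesis .
  qed
  hence "Re (B y') \<le> K\<^sup>2 * Re (B x')"
    unfolding split[OF x'c] split[OF y'c] Re_sum sum_distrib_left by (rule sum_mono)
  hence "sqrt (Re (B y')) \<le> sqrt (K\<^sup>2 * Re (B x'))" by (rule real_sqrt_le_mono)
  thus ?thesis using K by (simp add: norm_induced_def Bx By real_sqrt_mult)
qed

lemma norm_induced_nonneg:
  assumes "pos_def_mat n M" "v \<in> carrier_vec n"
  shows "0 \<le> norm_induced M v"
proof (cases "v = 0\<^sub>v n")
  case True
  have "M *\<^sub>v 0\<^sub>v n \<in> carrier_vec n" using assms(1) by (auto simp: pos_def_mat_def intro: mult_mat_vec_carrier)
  thus ?thesis unfolding True norm_induced_def by simp
next
  case False
  thus ?thesis using assms by (auto simp: norm_induced_def pos_def_mat_def intro: less_imp_le)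
qed

section \<open>Error coordinates and the final bound\<close>

context lanczos_run
begin

text \<open>The weights in front of \<open>g (\<theta> j)\<close> do not depend on \<open>g\<close>,
  so each coordinate of the error is a linear functional of \<open>g\<close>.\<close>

lemma lan_coord:
  assumes U: "U \<in> carrier_mat n n" and F: "eigendecomposition T V \<theta>" and i: "i < n"
  shows "(mat_adjoint U *\<^sub>v lan A b k g) $ i =
    (\<Sum>j<k. (mat_adjoint U * (Q * V)) $$ (i, j) * (mat_adjoint V *\<^sub>v (mat_adjoint Q *\<^sub>v b)) $ j * g (\<theta> j))"
proof -
  note U' = mat_adjoint_carrier[OF U] and V = eigendecompositionD(1)[OF F T_carrier]
  have Qb: "mat_adjoint Q *\<^sub>v b \<in> carrier_vec k"
    using mat_adjoint_carrier[OF Q_carrier] b_carrier by (rule mult_mat_vec_carrier)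
  define u where "u = vec k (\<lambda>j. g (\<theta> j) * (mat_adjoint V *\<^sub>v (mat_adjoint Q *\<^sub>v b)) $ j)"
  have u: "u \<in> carrier_vec k" by (simp add: u_def)
  note QV = mult_carrier_mat[OF Q_carrier V]
  have "mat_adjoint U *\<^sub>v lan A b k g = (mat_adjoint U * (Q * V)) *\<^sub>v u"
    unfolding lan_def mat_fun_mult_vec[OF F T_carrier Qb] u_def[symmetric]
      assoc_mult_mat_vec[OF U' QV u] assoc_mult_mat_vec[OF Q_carrier V u] ..
  thus ?thesis using mult_mat_vec_sum[OF mult_carrier_mat[OF U' QV] u i]
    by (auto simp: u_def mult_ac simp del: index_mult_mat_vec intro!: sum.cong)
qed

lemma lan_carrier: "lan A b k g \<in> carrier_vec n"
  unfolding lan_def using Q_carrier by (intro carrier_vecI) simp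

end

theorem corollary3p3:
  fixes A M :: "complex mat" and b :: "complex vec" and n k :: nat
    and f :: "complex \<Rightarrow> complex" and w :: real and S :: "complex set"
  assumes A: "A \<in> carrier_mat n n" "hermitian_mat A"
    and b: "b \<in> carrier_vec n" "b \<noteq> 0\<^sub>v n"
    and k: "1 \<le> k" "lanczos_no_breakdown A b k"
    and M: "pos_def_mat n M" "M * A = A * M"
    and w: "w < lambda_min A"
    and f: "open S" "cball (complex_of_real (lambda_max A)) (lambda_max A - w) \<subseteq> S"
      "f analytic_on S"
  shows "norm_induced M (mat_fun f A *\<^sub>v b - lan A b k f)
      \<le> (1 / (2 * pi) *
          arclength_integral (circlepath (complex_of_real (lambda_max A)) (lambda_max A - w))
            (\<lambda>z. cmod (f z))) *
        norm_induced M (lan_err A b k (complex_of_real w))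
    \<and> (1 / (2 * pi) *
          arclength_integral (circlepath (complex_of_real (lambda_max A)) (lambda_max A - w))
            (\<lambda>z. cmod (f z))) *
        norm_induced M (lan_err A b k (complex_of_real w))
      \<le> ((lambda_max A - w) *
          (SUP z \<in> sphere (complex_of_real (lambda_max A)) (lambda_max A - w). cmod (f z))) *
        norm_induced M (lan_err A b k (complex_of_real w))"
proof -
  interpret lanczos_run A b n k
    by unfold_locales (fact A b k)+
  define c where "c = lambda_max A"
  define K where "K = 1 / (2 * pi) * arclength_integral (circlepath c (c - w)) (\<lambda>z. cmod (f z))"
  obtain U d where E: "eigendecomposition A U (\<lambda>i. complex_of_real (d i))"
    using hermitian_eigendecomposition[OF A] .
  obtain V \<theta> where F: "eigendecomposition T V (\<lambda>i. complex_of_real (\<theta> i))"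
    using hermitian_eigendecomposition[OF T_carrier T_hermitian] .
  note DA = eigendecompositionD[OF E A(1)]
  have d: "w < d i" "d i \<le> c" if "i < n" for i
    using eigendecomposition_lambda_bounds[OF E A(1) that] w by (auto simp: c_def)
  have \<theta>: "w < \<theta> j \<and> \<theta> j \<le> c" if "j < k" for j
    using compression_eigenvalue_bounds[OF A Q_carrier Q_isometry T_compression F that] w
    by (auto simp: c_def)
  \<comment> \<open>Index 0 is a legitimate node because \<open>1 \<le> k\<close>.\<close>
  have wc: "w < c" using \<theta>[of 0] k by auto
  \<comment> \<open>Leaving the function open lets \<open>f\<close>, the resolvent and the monomials
    share one coordinate formula.\<close>
  define err where "err g = mat_fun g A *\<^sub>v b - lan A b k g" for g
  have fA: "mat_fun g A *\<^sub>v b \<in> carrier_vec n" for g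
    using DA(7) b(1) by (rule mult_mat_vec_carrier)
  have err: "err g \<in> carrier_vec n" for g
    unfolding err_def using fA lan_carrier by (rule minus_carrier_vec)
  \<comment> \<open>Both resolvents are matrix functions because \<open>w\<close> lies strictly
    below every \<open>d i\<close> and every \<open>\<theta> j\<close>.\<close>
  have lan_err: "lan_err A b k w = err (\<lambda>z. 1 / (z - w))"
    unfolding lan_err_def err_def lan_def
    using resolvent_eq_mat_fun[OF E A(1), of w] resolvent_eq_mat_fun[OF F T_carrier, of w] d \<theta> by force
  define y where "y i = (mat_adjoint U *\<^sub>v b) $ i" for i
  define a where "a i j = (mat_adjoint U * (Q * V)) $$ (i, j) * (mat_adjoint V *\<^sub>v (mat_adjoint Q *\<^sub>v b)) $ j" for i j
  have coord: "(mat_adjoint U *\<^sub>v err g) $ i = y i * g (d i) - (\<Sum>j<k. a i j * g (\<theta> j))" if i: "i < n" for g i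
  proof -
    have "mat_adjoint U *\<^sub>v err g = mat_adjoint U *\<^sub>v (mat_fun g A *\<^sub>v b) - mat_adjoint U *\<^sub>v lan A b k g"
      unfolding err_def by (rule mult_minus_distrib_mat_vec[OF DA(2) fA lan_carrier])
    hence "(mat_adjoint U *\<^sub>v err g) $ i = (mat_adjoint U *\<^sub>v (mat_fun g A *\<^sub>v b)) $ i - (mat_adjoint U *\<^sub>v lan A b k g) $ i"
      using i DA(1) by (simp del: index_mult_mat_vec)
    thus ?thesis
      unfolding mat_fun_coord[OF E A(1) b(1) i] lan_coord[OF DA(1) F i] y_def a_def by (simp add: mult.commute)
  qed
  have mom: "y i * complex_of_real (d i) ^ m = (\<Sum>j<k. a i j * complex_of_real (\<theta> j) ^ m)" if "i < n" "m < k" for i m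
  proof -
    \<comment> \<open>Exactness on low powers, read off in a single coordinate, is the moment
      condition.\<close>
    have "err (\<lambda>z. z ^ m) = 0\<^sub>v n" unfolding err_def lan_power[OF that(2)] using lan_carrier by simp
    moreover have "mat_adjoint U *\<^sub>v 0\<^sub>v n = 0\<^sub>v n"
      using DA(1) by (intro eq_vecI) (auto simp: mult_mat_vec_sum[OF DA(2)] simp del: index_mult_mat_vec)
    ultimately show ?thesis using coord[OF that(1), of "\<lambda>z. z ^ m"] that(1) by simp
  qed
  have hol: "f holomorphic_on S" by (rule analytic_imp_holomorphic[OF f(3)])
  have fcont: "continuous_on (sphere (complex_of_real c) (c - w)) f"
    using holomorphic_on_imp_continuous_on[OF hol] f(2) sphere_cball
    unfolding c_def by (meson continuous_on_subset)
  let ?G = "resolvent_transfer f c w k \<theta>"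
  have Gle: "cmod (?G (d i)) \<le> K" if "i < n" for i
    unfolding K_def by (rule resolvent_transfer_bound[OF fcont d[OF that] \<theta>])
  \<comment> \<open>A nonzero \<open>b\<close> forces a positive dimension, so the bound at index 0
    is available to show that \<open>K\<close> is nonnegative.\<close>
  have "n \<noteq> 0" using b by auto
  hence K0: "0 \<le> K" using Gle[of 0] norm_ge_zero order_trans by blast
  have "(mat_adjoint U *\<^sub>v err f) $ i = ?G (d i) * (mat_adjoint U *\<^sub>v err (\<lambda>z. 1 / (z - w))) $ i" if "i < n" for i
    unfolding coord[OF that]
    by (rule resolvent_transfer[OF hol f(2)[folded c_def] d[OF that] \<theta> k(1) mom[OF that]])
  hence 1: "norm_induced M (err f) \<le> K * norm_induced M (err (\<lambda>z. 1 / (z - w)))"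
    by (intro norm_induced_spectral_multiplier[where G = ?G, OF A M E err err K0 Gle])
  have 2: "K * norm_induced M (err (\<lambda>z. 1 / (z - w))) \<le>
      ((c - w) * (SUP z \<in> sphere (complex_of_real c) (c - w). cmod (f z))) * norm_induced M (err (\<lambda>z. 1 / (z - w)))"
    unfolding K_def using wc
    by (intro mult_right_mono arclength_integral_circlepath_le fcont norm_induced_nonneg[OF M(1) err]) auto
  show ?thesis using 1 2 unfolding lan_err K_def err_def[of f, symmetric] c_def by blast
qed

end
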